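(* Let $\Delta x,\Delta y>0$, let $c=[-\frac{\Delta x}{2},\frac{\Delta x}{2}]\times[-\frac{\Delta y}{2},\frac{\Delta y}{2}]$, and let real numbers $q_{NW},q_N,q_{NE},q_W,q_E,q_{SW},q_S,q_{SE}$ (point values) and $\bar q$ (cell average) be given. Let $m$ and $M$ be the minimum and the maximum of the eight point values. Define $q_{\rm recon}:c\to\mathbb R$ as follows, with $q^{\rm pw}_{\rm recon}$ (piecewise-biparabolic reconstruction) and $q^{\rm plateau}_{\rm recon}$ (plateau reconstruction, with its parameters $\eta,q_p$) as defined in the context: if $m<\bar q<M$ does not hold, or if $m<\bar q<M$ and additionally $m\le q^{\rm pw}_{\rm recon}(x,y)\le M$ for all $(x,y)\in c$, then $q_{\rm recon}:=q^{\rm pw}_{\rm recon}$; otherwise $q_{\rm recon}:=q^{\rm plateau}_{\rm recon}$. Then $q_{\rm recon}$ is continuous on $c$; it interpolates all eight point values at their locations on the boundary of $c$; its average satisfies $\frac{1}{\Delta x\Delta y}\int_c q_{\rm recon}(x,y)\,dx\,dy=\bar q$; and (i) if $m<\bar q<M$, then $m\le q_{\rm recon}(x,y)\le M$ for all $(x,y)\in c$; (ii) if $q_{NW}<q_N<q_{NE}$, then $q_{NW}\le q_{\rm recon}(x,y)\le q_{NE}$ for all $(x,y)$ on the N-edge, and similarly for the other edges (S-edge: if $q_{SW}<q_S<q_{SE}$, then $q_{SW}\le q_{\rm recon}\le q_{SE}$ on it; W-edge: if $q_{SW}<q_W<q_{NW}$, then $q_{SW}\le q_{\rm recon}\le q_{NW}$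 on it; E-edge: if $q_{SE}<q_E<q_{NE}$, then $q_{SE}\le q_{\rm recon}\le q_{NE}$ on it).
   Context: **Locations.** The N-, S-, W-, E-edges of $c$ are the sides $y=\frac{\Delta y}2$, $y=-\frac{\Delta y}2$, $x=-\frac{\Delta x}2$, $x=\frac{\Delta x}2$. The values $q_N,q_S,q_W,q_E$ are located at the midpoints of these edges and $q_{NW},q_{NE},q_{SW},q_{SE}$ at the corners, e.g. $q_{NW}$ at $(-\frac{\Delta x}2,\frac{\Delta y}2)$, $q_{SE}$ at $(\frac{\Delta x}2,-\frac{\Delta y}2)$. Write $X=x/\Delta x$, $Y=y/\Delta y$. **Edge types.** For an edge with end values $\alpha,\gamma$ and midpoint value $\beta$, the edge has type "hat" if either (1) $\alpha\neq\gamma$ and neither $\alpha<\beta<\gamma$ nor $\alpha>\beta>\gamma$, or (2) $\alpha<\beta<\gamma$ or $\alpha>\beta>\gamma$, and $|\beta-\frac{\alpha+\gamma}{2}|>\frac{|\gamma-\alpha|}{4}$. Otherwise it has type "par" (parabolic). Denote the types of the four edges by $\tau_N,\tau_S,\tau_W,\tau_E$. **The function $\mathcal W$.** For types $s,n,w\in\{\text{par},\text{hat}\}$ and $a,b,e,r\in\mathbb R$ define $\mathcal W_{s,n,w}(a,b,e;X,Y;r)$ for $X,Y\in[-\frac12,\frac12]$ as $$C-bX-2(2C-b)X^2+(a_4X+a_5X^2)Y+(-4C+a_7X+a_8X^2)Y^2,$$ with $(a_4,a_5,a_7,a_8)$ and $C$ as follows. If $w=$ par: - $s=n=$ par: $(-(e-a),\,2(e-a),\,-2(e+a-2b),\,4(4C+e+a-2b))$;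 $C=\frac1{16}(36r-e-a-4b)$. - $s=n=$ hat: for $X<0$: $(-2(e-a),\,0,\,-4(e+a-b),\,8(2C-b))$; for $X\ge0$: $(0,\,0,\,4b,\,8(2C-b))$; $C=\frac1{32}(72r-3e-3a-8b)$. - $s=$ par, $n=$ hat: for $X<0$: $(-(2e-a),\,-2a,\,-2(2e+a-2b),\,4(4C+a-2b))$; for $X\ge0$: $(a,\,-2a,\,-2(a-2b),\,4(4C+a-2b))$; $C=\frac1{32}(72r-3e-2a-8b)$. - $s=$ hat, $n=$ par: for $X<0$: $(-(e-2a),\,2e,\,-2(e+2a-2b),\,4(4C+e-2b))$; for $X\ge0$: $(-e,\,2e,\,-2(e-2b),\,4(4C+e-2b))$; $C=\frac1{32}(72r-2e-3a-8b)$. If $w=$ hat: - for $Y\ge0$, $n=$ par: $(-2(e-b),\,4(e-b),\,0,\,16C)$. - for $Y\ge0$, $n=$ hat: if $X<0$: $(-(3e-2b),\,2(e-2b),\,-2e,\,4(4C-e))$; if $X\ge0$: $(a,\,-2a,\,-2(a-2b),\,4(4C+a-2b))$. - for $Y<0$, $s=$ par: $(2(a-b),\,-4(a-b),\,0,\,16C)$. - for $Y<0$, $s=$ hat: if $X<0$: $(3a-2b,\,-2(a-2b),\,-2a,\,4(4C-a))$; if $X\ge0$: $(-e,\,2e,\,-2(e-2b),\,4(4C+e-2b))$. - $C$ is the solution of $r=\frac{4C}{9}+I_n+I_s$, where $I_n=\frac{e+b}{24}$ if $n=$ par, $I_n=\frac{35e+a+22b}{576}$ if $n=$ hat, $I_s=\frac{a+b}{24}$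 if $s=$ par, $I_s=\frac{e+35a+22b}{576}$ if $s=$ hat. **Piecewise-biparabolic reconstruction.** With $\bar Q=\frac18(q_{SW}+q_W+q_{NW}+q_N+q_{NE}+q_E+q_{SE}+q_S)$ and $r=\frac{\bar q-\bar Q}{4}$, $$\begin{aligned}q^{\rm pw}_{\rm recon}(x,y)=\bar Q&+\mathcal W_{\tau_S,\tau_N,\tau_W}\big(\tfrac{q_{SW}-\bar Q}2,q_W-\bar Q,\tfrac{q_{NW}-\bar Q}2;X,Y;r\big)\\&+\mathcal W_{\tau_E,\tau_W,\tau_S}\big(\tfrac{q_{SE}-\bar Q}2,q_S-\bar Q,\tfrac{q_{SW}-\bar Q}2;Y,-X;r\big)\\&+\mathcal W_{\tau_W,\tau_E,\tau_N}\big(\tfrac{q_{NW}-\bar Q}2,q_N-\bar Q,\tfrac{q_{NE}-\bar Q}2;-Y,X;r\big)\\&+\mathcal W_{\tau_N,\tau_S,\tau_E}\big(\tfrac{q_{NE}-\bar Q}2,q_E-\bar Q,\tfrac{q_{SE}-\bar Q}2;-X,-Y;r\big).\end{aligned}$$ **Plateau reconstruction** (used only when $m<\bar q<M$). For $\eta\in(0,\frac12)$, $p\in\mathbb R$, let $D_\eta=\{(X,Y):-\frac12\le X\le-\frac12+\eta,\ X\le Y\le -X\}$ and define on $D_\eta$: - $\mathcal T_{\rm par}(a,b,e;X,Y)=p\,\frac{1+2X}{2\eta}+(2\eta-1-2X)\Big(\frac{b}{2\eta}-\frac{(e-a)Y}{4\eta X}+\frac{(e+a-2b)Y^2}{4\eta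 X^2}\Big)$; - $\mathcal T_{\rm hat}(a,b,e;X,Y)=b-\frac{(e-b)Y}{X}+\frac{X+1/2}{\eta}\Big(p-b+\frac{(e-b)Y}{X}\Big)$ for $Y\ge0$, and $=b+\frac{(a-b)Y}{X}+\frac{X+1/2}{\eta}\Big(p-b-\frac{(a-b)Y}{X}\Big)$ for $Y<0$. Then, with $p=q_p$, - $q^{\rm plateau}_{\rm recon}(x,y)=q_p$ if $|X|\le\frac12-\eta$ and $|Y|\le\frac12-\eta$ (the plateau); - $=\mathcal T_{\tau_W}(q_{SW},q_W,q_{NW};X,Y)$ if $(X,Y)\in D_\eta$ (W-trapeze); - $=\mathcal T_{\tau_S}(q_{SE},q_S,q_{SW};Y,-X)$ if $(Y,-X)\in D_\eta$ (S-trapeze); - $=\mathcal T_{\tau_N}(q_{NW},q_N,q_{NE};-Y,X)$ if $(-Y,X)\in D_\eta$ (N-trapeze); - $=\mathcal T_{\tau_E}(q_{NE},q_E,q_{SE};-X,-Y)$ if $(-X,-Y)\in D_\eta$ (E-trapeze). (On overlaps of these regions the definitions agree.) **Parameters $\eta,q_p$.** For an edge with end values $\alpha,\gamma$ and midpoint value $\beta$ let its mean be $\frac{\alpha+4\beta+\gamma}{6}$ if it has type par and $\frac{\alpha+2\beta+\gamma}{4}$ if it has type hat, and let $\Sigma$ be the sum of the four edge means. For given $\eta$, $q_p$ is determined by requiring the average of $q^{\rm plateau}_{\rm recon}$ over $c$ to be $\bar q$, which gives $q_p(\eta)=\frac{6\bar q-\eta(3-2\eta)\Sigma}{6-12\eta+8\eta^2}$.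 The parameter $\eta$ is half of the smallest real positive solution of $q_p(\eta)=m$ or $q_p(\eta)=M$ (both quadratic equations in $\eta$); if there is no real positive solution, $\eta=\frac14$. Then $q_p=q_p(\eta)$. *)

theory Defs
  imports "HOL-Analysis.Analysis"
begin

datatype location =
  NorthWest | North | NorthEast | West | East | SouthWest | South | SouthEast

definition cell :: "real \<Rightarrow> real \<Rightarrow> (real \<times> real) set" where
  "cell dx dy = {- dx / 2..dx / 2} \<times> {- dy / 2..dy / 2}"

fun position :: "real \<Rightarrow> real \<Rightarrow> location \<Rightarrow> real \<times> real" where
  "position dx dy NorthWest = (- dx / 2, dy / 2)"
| "position dx dy North = (0, dy / 2)"
| "position dx dy NorthEast = (dx / 2, dy / 2)"
| "position dx dy West = (- dx / 2, 0)"
| "position dx dy East = (dx / 2, 0)"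
| "position dx dy SouthWest = (- dx / 2, - dy / 2)"
| "position dx dy South = (0, - dy / 2)"
| "position dx dy SouthEast = (dx / 2, - dy / 2)"

lemma UNIV_location:
  "UNIV = {NorthWest, North, NorthEast, West, East, SouthWest, South, SouthEast}"
proof -
  have "l \<in> {NorthWest, North, NorthEast, West, East, SouthWest, South, SouthEast}" for l
    by (cases l) simp_all
  then show ?thesis by blast
qed

definition q_min :: "(location \<Rightarrow> real) \<Rightarrow> real" where
  "q_min q = Min (range q)"

definition q_max :: "(location \<Rightarrow> real) \<Rightarrow> real" where
  "q_max q = Max (range q)"

definition Q_bar :: "(location \<Rightarrow> real) \<Rightarrow> real" where
  "Q_bar q = (q SouthWest + q West + q NorthWest + q North
            + q NorthEast + q East + q SouthEast + q South) / 8"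

datatype edge_type = Par | Hat

text \<open>Arguments: end value, midpoint value, end value. The type does not depend on the
  direction in which the edge is traversed.\<close>

definition edge_type_of :: "real \<Rightarrow> real \<Rightarrow> real \<Rightarrow> edge_type" where
  "edge_type_of \<alpha> \<beta> \<gamma> =
    (if (\<alpha> \<noteq> \<gamma> \<and> \<not> (\<alpha> < \<beta> \<and> \<beta> < \<gamma>) \<and> \<not> (\<alpha> > \<beta> \<and> \<beta> > \<gamma>))
        \<or> ((\<alpha> < \<beta> \<and> \<beta> < \<gamma> \<or> \<alpha> > \<beta> \<and> \<beta> > \<gamma>) \<and> \<bar>\<beta> - (\<alpha> + \<gamma>) / 2\<bar> > \<bar>\<gamma> - \<alpha>\<bar> / 4)
     then Hat else Par)"

definition type_N :: "(location \<Rightarrow> real) \<Rightarrow> edge_type" where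
  "type_N q = edge_type_of (q NorthWest) (q North) (q NorthEast)"

definition type_S :: "(location \<Rightarrow> real) \<Rightarrow> edge_type" where
  "type_S q = edge_type_of (q SouthWest) (q South) (q SouthEast)"

definition type_W :: "(location \<Rightarrow> real) \<Rightarrow> edge_type" where
  "type_W q = edge_type_of (q SouthWest) (q West) (q NorthWest)"

definition type_E :: "(location \<Rightarrow> real) \<Rightarrow> edge_type" where
  "type_E q = edge_type_of (q SouthEast) (q East) (q NorthEast)"

text \<open>The edge types are always passed in the order \<open>s n w\<close>. The function
  \<open>W_fun s n w\<close> has values \<open>a\<close>, \<open>b\<close>, \<open>e\<close> at the points
  \<open>(-1/2, -1/2)\<close>, \<open>(-1/2, 0)\<close>, \<open>(-1/2, 1/2)\<close> of the unit cell, value \<open>C\<close> at its centre,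
  and average \<open>r\<close>.\<close>

fun hat_In :: "edge_type \<Rightarrow> real \<Rightarrow> real \<Rightarrow> real \<Rightarrow> real" where
  "hat_In Par a b e = (e + b) / 24"
| "hat_In Hat a b e = (35 * e + a + 22 * b) / 576"

fun hat_Is :: "edge_type \<Rightarrow> real \<Rightarrow> real \<Rightarrow> real \<Rightarrow> real" where
  "hat_Is Par a b e = (a + b) / 24"
| "hat_Is Hat a b e = (e + 35 * a + 22 * b) / 576"

fun W_centre ::
  "edge_type \<Rightarrow> edge_type \<Rightarrow> edge_type \<Rightarrow> real \<Rightarrow> real \<Rightarrow> real \<Rightarrow> real \<Rightarrow> real" where
  "W_centre Par Par Par a b e r = (36 * r - e - a - 4 * b) / 16"
| "W_centre Hat Hat Par a b e r = (72 * r - 3 * e - 3 * a - 8 * b) / 32"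
| "W_centre Par Hat Par a b e r = (72 * r - 3 * e - 2 * a - 8 * b) / 32"
| "W_centre Hat Par Par a b e r = (72 * r - 2 * e - 3 * a - 8 * b) / 32"
| "W_centre s n Hat a b e r = (THE C. r = 4 * C / 9 + hat_In n a b e + hat_Is s a b e)"

lemma W_centre_Hat: "W_centre s n Hat a b e r = 9 / 4 * (r - hat_In n a b e - hat_Is s a b e)"
proof -
  have "(r = 4 * C / 9 + hat_In n a b e + hat_Is s a b e) =
      (C = 9 / 4 * (r - hat_In n a b e - hat_Is s a b e))" for C
    by auto
  then show ?thesis by (simp only: W_centre.simps the_eq_trivial)
qed

text \<open>The coefficients \<open>(a\<^sub>4, a\<^sub>5, a\<^sub>7, a\<^sub>8)\<close>, depending on the
  position \<open>(X, Y)\<close> and on the centre value \<open>C\<close>.\<close>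

fun W_coeffs ::
  "edge_type \<Rightarrow> edge_type \<Rightarrow> edge_type \<Rightarrow> real \<Rightarrow> real \<Rightarrow> real \<Rightarrow> real \<Rightarrow> real \<Rightarrow> real
    \<Rightarrow> real \<times> real \<times> real \<times> real" where
  "W_coeffs Par Par Par a b e C X Y =
    (- (e - a), 2 * (e - a), - 2 * (e + a - 2 * b), 4 * (4 * C + e + a - 2 * b))"
| "W_coeffs Hat Hat Par a b e C X Y =
    (if X < 0 then (- 2 * (e - a), 0, - 4 * (e + a - b), 8 * (2 * C - b))
     else (0, 0, 4 * b, 8 * (2 * C - b)))"
| "W_coeffs Par Hat Par a b e C X Y =
    (if X < 0 then (- (2 * e - a), - 2 * a, - 2 * (2 * e + a - 2 * b), 4 * (4 * C + a - 2 * b))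
     else (a, - 2 * a, - 2 * (a - 2 * b), 4 * (4 * C + a - 2 * b)))"
| "W_coeffs Hat Par Par a b e C X Y =
    (if X < 0 then (- (e - 2 * a), 2 * e, - 2 * (e + 2 * a - 2 * b), 4 * (4 * C + e - 2 * b))
     else (- e, 2 * e, - 2 * (e - 2 * b), 4 * (4 * C + e - 2 * b)))"
| "W_coeffs s n Hat a b e C X Y =
    (if Y \<ge> 0 then
       (case n of
          Par \<Rightarrow> (- 2 * (e - b), 4 * (e - b), 0, 16 * C)
        | Hat \<Rightarrow>
            (if X < 0 then (- (3 * e - 2 * b), 2 * (e - 2 * b), - 2 * e, 4 * (4 * C - e))
             else (a, - 2 * a, - 2 * (a - 2 * b), 4 * (4 * C + a - 2 * b))))
     else
       (case s of
          Par \<Rightarrow> (2 * (a - b), - 4 * (a - b), 0, 16 * C)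
        | Hat \<Rightarrow>
            (if X < 0 then (3 * a - 2 * b, - 2 * (a - 2 * b), - 2 * a, 4 * (4 * C - a))
             else (- e, 2 * e, - 2 * (e - 2 * b), 4 * (4 * C + e - 2 * b)))))"

definition W_fun ::
  "edge_type \<Rightarrow> edge_type \<Rightarrow> edge_type \<Rightarrow> real \<Rightarrow> real \<Rightarrow> real \<Rightarrow> real \<Rightarrow> real \<Rightarrow> real \<Rightarrow> real" where
  "W_fun s n w a b e X Y r =
    (let C = W_centre s n w a b e r;
         (a4, a5, a7, a8) = W_coeffs s n w a b e C X Y
     in C - b * X - 2 * (2 * C - b) * X\<^sup>2 + (a4 * X + a5 * X\<^sup>2) * Y
        + (- 4 * C + a7 * X + a8 * X\<^sup>2) * Y\<^sup>2)"

definition q_pw :: "real \<Rightarrow> real \<Rightarrow> (location \<Rightarrow> real) \<Rightarrow> real \<Rightarrow> real \<times> real \<Rightarrow> real" where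
  "q_pw dx dy q qbar = (\<lambda>(x, y).
    let X = x / dx; Y = y / dy; Q = Q_bar q; r = (qbar - Q) / 4 in
    Q + W_fun (type_S q) (type_N q) (type_W q)
          ((q SouthWest - Q) / 2) (q West - Q) ((q NorthWest - Q) / 2) X Y r
      + W_fun (type_E q) (type_W q) (type_S q)
          ((q SouthEast - Q) / 2) (q South - Q) ((q SouthWest - Q) / 2) Y (- X) r
      + W_fun (type_W q) (type_E q) (type_N q)
          ((q NorthWest - Q) / 2) (q North - Q) ((q NorthEast - Q) / 2) (- Y) X r
      + W_fun (type_N q) (type_S q) (type_E q)
          ((q NorthEast - Q) / 2) (q East - Q) ((q SouthEast - Q) / 2) (- X) (- Y) r)"

definition trapeze :: "real \<Rightarrow> (real \<times> real) set" where
  "trapeze \<eta> = {(X, Y). - 1 / 2 \<le> X \<and> X \<le> - 1 / 2 + \<eta> \<and> X \<le> Y \<and> Y \<le> - X}"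

fun T_fun ::
  "edge_type \<Rightarrow> real \<Rightarrow> real \<Rightarrow> real \<Rightarrow> real \<Rightarrow> real \<Rightarrow> real \<Rightarrow> real \<Rightarrow> real" where
  "T_fun Par \<eta> p a b e X Y =
    p * ((1 + 2 * X) / (2 * \<eta>))
    + (2 * \<eta> - 1 - 2 * X) * (b / (2 * \<eta>) - (e - a) * Y / (4 * \<eta> * X)
        + (e + a - 2 * b) * Y\<^sup>2 / (4 * \<eta> * X\<^sup>2))"
| "T_fun Hat \<eta> p a b e X Y =
    (if Y \<ge> 0 then
       b - (e - b) * Y / X + (X + 1 / 2) / \<eta> * (p - b + (e - b) * Y / X)
     else
       b + (a - b) * Y / X + (X + 1 / 2) / \<eta> * (p - b - (a - b) * Y / X))"

text \<open>For \<open>0 < \<eta> < 1/2\<close> the five regions below cover the cell, and on overlaps the corresponding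
  expressions agree, so the order of the case distinction does not matter. The final value \<open>0\<close>
  is only used outside the cell.\<close>

definition q_plateau_at ::
  "real \<Rightarrow> real \<Rightarrow> real \<Rightarrow> real \<Rightarrow> (location \<Rightarrow> real) \<Rightarrow> real \<times> real \<Rightarrow> real" where
  "q_plateau_at \<eta> p dx dy q = (\<lambda>(x, y).
    let X = x / dx; Y = y / dy in
    if \<bar>X\<bar> \<le> 1 / 2 - \<eta> \<and> \<bar>Y\<bar> \<le> 1 / 2 - \<eta> then p
    else if (X, Y) \<in> trapeze \<eta> then
      T_fun (type_W q) \<eta> p (q SouthWest) (q West) (q NorthWest) X Y
    else if (Y, - X) \<in> trapeze \<eta> then
      T_fun (type_S q) \<eta> p (q SouthEast) (q South) (q SouthWest) Y (- X)
    else if (- Y, X) \<in> trapeze \<eta> then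
      T_fun (type_N q) \<eta> p (q NorthWest) (q North) (q NorthEast) (- Y) X
    else if (- X, - Y) \<in> trapeze \<eta> then
      T_fun (type_E q) \<eta> p (q NorthEast) (q East) (q SouthEast) (- X) (- Y)
    else 0)"

definition edge_mean :: "real \<Rightarrow> real \<Rightarrow> real \<Rightarrow> real" where
  "edge_mean \<alpha> \<beta> \<gamma> =
    (case edge_type_of \<alpha> \<beta> \<gamma> of
       Par \<Rightarrow> (\<alpha> + 4 * \<beta> + \<gamma>) / 6
     | Hat \<Rightarrow> (\<alpha> + 2 * \<beta> + \<gamma>) / 4)"

definition edge_mean_sum :: "(location \<Rightarrow> real) \<Rightarrow> real" where
  "edge_mean_sum q =
     edge_mean (q NorthWest) (q North) (q NorthEast)
   + edge_mean (q SouthWest) (q South) (q SouthEast)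
   + edge_mean (q SouthWest) (q West) (q NorthWest)
   + edge_mean (q SouthEast) (q East) (q NorthEast)"

definition plateau_value :: "(location \<Rightarrow> real) \<Rightarrow> real \<Rightarrow> real \<Rightarrow> real" where
  "plateau_value q qbar \<eta> =
    (6 * qbar - \<eta> * (3 - 2 * \<eta>) * edge_mean_sum q) / (6 - 12 * \<eta> + 8 * \<eta>\<^sup>2)"

text \<open>The denominator of \<open>plateau_value\<close> has no real zeros. If \<open>q_min q < qbar < q_max q\<close>, the set
  of positive solutions is finite, so that a least element exists whenever it is nonempty.\<close>

definition plateau_eta :: "(location \<Rightarrow> real) \<Rightarrow> real \<Rightarrow> real" where
  "plateau_eta q qbar =
    (let sol = (\<lambda>\<eta>. \<eta> > 0 \<and> (plateau_value q qbar \<eta> = q_min q \<or> plateau_value q qbar \<eta> = q_max q))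
     in if \<exists>\<eta>. sol \<eta> then (LEAST \<eta>. sol \<eta>) / 2 else 1 / 4)"

definition q_plateau :: "real \<Rightarrow> real \<Rightarrow> (location \<Rightarrow> real) \<Rightarrow> real \<Rightarrow> real \<times> real \<Rightarrow> real" where
  "q_plateau dx dy q qbar =
    (let \<eta> = plateau_eta q qbar in q_plateau_at \<eta> (plateau_value q qbar \<eta>) dx dy q)"

definition q_recon :: "real \<Rightarrow> real \<Rightarrow> (location \<Rightarrow> real) \<Rightarrow> real \<Rightarrow> real \<times> real \<Rightarrow> real" where
  "q_recon dx dy q qbar =
    (if \<not> (q_min q < qbar \<and> qbar < q_max q)
        \<or> (q_min q < qbar \<and> qbar < q_max q
           \<and> (\<forall>z \<in> cell dx dy. q_min q \<le> q_pw dx dy q qbar z \<and> q_pw dx dy q qbar z \<le> q_max q))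
     then q_pw dx dy q qbar else q_plateau dx dy q qbar)"

end

theory Submission
  imports Defs
begin

text \<open>
Both reconstructions restrict on each edge to the same one-dimensional curve, the
\<open>profile\<close> of the edge: the parabola or the two-piece linear interpolant through the three point
values, according to the type of the edge. Interpolation and the monotonicity statement (ii) are
therefore statements about profiles. A hat profile is a convex combination of its nodes. A
parabolic profile stays between its nodes because an edge has type \<open>Par\<close> only if the two end
values coincide or the midpoint value is close enough to their mean to make the parabola
monotone (\<open>profile_bounds\<close>).

For the piecewise-biparabolic reconstruction, each function \<open>W_fun\<close> vanishes on the edge opposite to its own
one and carries half of a corner value on the two adjacent edges, so that the four rotated copies
add up to the profile on every edge (\<open>q_pw_edges\<close>). Written in the functions \<open>min t 0\<close> and
\<open>max t 0\<close> of the two coordinates, \<open>W_fun\<close> is a single formula; continuity is then evident,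
and the average is a combination of the moments of these functions. It equals \<open>r\<close> by the choice
of the centre value, and the four copies restore \<open>qbar\<close>.

For the plateau reconstruction, \<open>T_fun\<close> is a convex combination of the plateau value and the
profile evaluated at \<open>- Y / X\<close>, where the ray from the centre through the point meets the edge
(\<open>T_fun_eq_profile\<close>). This gives agreement on the overlaps, continuity and the bounds, provided
that the plateau value lies between the extreme point values and \<open>0 < \<eta> < 1 / 2\<close>. Its average is
\<open>p + \<eta> (3 - 2 \<eta>) / 6 * (\<Sigma> - 4 p)\<close>, where \<open>\<Sigma>\<close> is the sum of the edge means, and
\<open>plateau_value\<close> is the value \<open>p\<close> for which this equals \<open>qbar\<close>.

The parameters are admissible for the following reason (\<open>plateau_parameters\<close>). The value
\<open>plateau_value q qbar \<eta>\<close> depends on \<open>\<eta>\<close> only through \<open>\<eta> (3 - 2 \<eta>)\<close>, hence is symmetric about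
\<open>\<eta> = 3 / 4\<close>; for \<open>\<eta> \<ge> 3 / 2\<close> it is a weighted mean of \<open>qbar\<close> and \<open>\<Sigma> / 4\<close>, so it does not reach
the extreme values there. Hence the least positive solution, if any, is at most \<open>3 / 4\<close>, and half of
it is below \<open>1 / 2\<close>. Starting from \<open>qbar\<close> at \<open>\<eta> = 0\<close>, the value cannot leave the open interval
between the extreme values before that solution, by the intermediate value theorem.
\<close>

section \<open>The curve on an edge\<close>

text \<open>The parameter \<open>t\<close> runs through \<open>[-1, 1]\<close> along the edge. Writing the hat with \<open>min\<close> and \<open>max\<close>
instead of a case distinction makes it linear in the three node values, evidently continuous, and
an instance of the integrands treated in \<open>has_bochner_integral_halfwise_quadratic\<close>.\<close>

definition profile :: "edge_type \<Rightarrow> real \<Rightarrow> real \<Rightarrow> real \<Rightarrow> real \<Rightarrow> real" where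
  "profile \<tau> a b e t =
    (case \<tau> of
       Par \<Rightarrow> b + (e - a) / 2 * t + (e + a - 2 * b) / 2 * t\<^sup>2
     | Hat \<Rightarrow> b + (b - a) * min t 0 + (e - b) * max t 0)"

lemma profile_reverse: "profile \<tau> a b e (- t) = profile \<tau> e b a t"
  by (cases \<tau>; cases "t \<le> 0") (simp_all add: profile_def algebra_simps add_divide_distrib diff_divide_distrib)

lemma profile_nodes [simp]:
  "profile \<tau> a b e (- 1) = a" "profile \<tau> a b e 0 = b" "profile \<tau> a b e 1 = e"
  by (cases \<tau>; simp add: profile_def field_simps)+

text \<open>Corner values enter the piecewise-biparabolic reconstruction twice, once from each adjacent edge,
and therefore with weight \<open>1 / 2\<close>. On an edge, its own building block contributes the first profile
below and its two neighbours the other two.\<close>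

lemma profile_superpose:
  "Q + profile \<tau> ((a - Q) / 2) (b - Q) ((e - Q) / 2) t
     + profile \<tau> ((a - Q) / 2) 0 0 t + profile \<tau> 0 0 ((e - Q) / 2) t
   = profile \<tau> a b e t"
  by (cases \<tau>; cases "t \<le> 0") (simp_all add: profile_def algebra_simps add_divide_distrib diff_divide_distrib)

lemma edge_type_of_commute: "edge_type_of a b e = edge_type_of e b a"
  unfolding edge_type_of_def by (rule if_cong) (auto simp: abs_minus_commute add.commute)

text \<open>For an increasing parabola, both \<open>profile - a\<close> and \<open>e - profile\<close> have a linear factor vanishing at the
respective end; the bound \<open>\<bar>b - (a + e) / 2\<bar> \<le> \<bar>e - a\<bar> / 4\<close> on a parabolic edge is exactly what makes
the cofactor nonnegative on \<open>[-1, 1]\<close>. If the ends coincide, the parabola is a convex combination of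
\<open>b\<close> and \<open>e\<close> with weights \<open>1 - t\<^sup>2\<close> and \<open>t\<^sup>2\<close>.\<close>

lemma profile_bounds:
  assumes "lo \<le> a" "lo \<le> b" "lo \<le> e" "a \<le> hi" "b \<le> hi" "e \<le> hi" "-1 \<le> t" "t \<le> 1"
  shows "lo \<le> profile (edge_type_of a b e) a b e t \<and> profile (edge_type_of a b e) a b e t \<le> hi"
proof -
  have increasing: "a \<le> b + (e - a) / 2 * t + (e + a - 2 * b) / 2 * t\<^sup>2
      \<and> b + (e - a) / 2 * t + (e + a - 2 * b) / 2 * t\<^sup>2 \<le> e"
    if "2 * \<bar>e + a - 2 * b\<bar> \<le> e - a" "-1 \<le> t" "t \<le> 1" for a b e t :: real
  proof -
    have curv: "\<bar>(e + a - 2 * b) * s\<bar> \<le> e - a" if "\<bar>s\<bar> \<le> 2" for s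
    proof -
      have "\<bar>(e + a - 2 * b) * s\<bar> \<le> \<bar>e + a - 2 * b\<bar> * 2"
        unfolding abs_mult using that by (intro mult_left_mono) auto
      with \<open>2 * \<bar>e + a - 2 * b\<bar> \<le> e - a\<close> show ?thesis by linarith
    qed
    have "0 \<le> (t + 1) * (((e - a) + (e + a - 2 * b) * (t - 1)) / 2)"
      using curv[of "t - 1"] that by (intro mult_nonneg_nonneg) auto
    moreover have "0 \<le> (1 - t) * (((e - a) + (e + a - 2 * b) * (t + 1)) / 2)"
      using curv[of "t + 1"] that by (intro mult_nonneg_nonneg) auto
    ultimately show ?thesis by (simp add: power2_eq_square field_simps)
  qed
  show ?thesis
  proof (cases "edge_type_of a b e")
    case Hat
    show ?thesis
    proof (cases "t \<le> 0")
      case True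
      have eq: "profile Hat a b e t = (1 + t) * b + (- t) * a"
        using True by (simp add: profile_def algebra_simps)
      have "(1 + t) * b + (- t) * a \<ge> (1 + t) * lo + (- t) * lo"
        using assms True by (intro add_mono mult_left_mono) auto
      moreover have "(1 + t) * b + (- t) * a \<le> (1 + t) * hi + (- t) * hi"
        using assms True by (intro add_mono mult_left_mono) auto
      ultimately show ?thesis unfolding Hat eq by (simp add: algebra_simps)
    next
      case False
      have eq: "profile Hat a b e t = (1 - t) * b + t * e"
        using False by (simp add: profile_def algebra_simps)
      have "(1 - t) * b + t * e \<ge> (1 - t) * lo + t * lo"
        using assms False by (intro add_mono mult_left_mono) auto
      moreover have "(1 - t) * b + t * e \<le> (1 - t) * hi + t * hi"
        using assms False by (intro add_mono mult_left_mono) auto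
      ultimately show ?thesis unfolding Hat eq by (simp add: algebra_simps)
    qed
  next
    case Par
    then have "\<bar>b - (a + e) / 2\<bar> \<le> \<bar>e - a\<bar> / 4" if "a \<noteq> e"
      using that unfolding edge_type_of_def by (auto split: if_splits)
    moreover have "2 * \<bar>b - (a + e) / 2\<bar> = \<bar>e + a - 2 * b\<bar>"
      by (simp add: abs_if field_simps)
    ultimately have "2 * \<bar>e + a - 2 * b\<bar> \<le> \<bar>e - a\<bar>" if "a \<noteq> e"
      using that by fastforce
    then have "a = e \<or> 2 * \<bar>e + a - 2 * b\<bar> \<le> e - a \<or> 2 * \<bar>a + e - 2 * b\<bar> \<le> a - e"
      by (cases "a \<le> e") (auto simp: add.commute)
    then consider "a = e" | "2 * \<bar>e + a - 2 * b\<bar> \<le> e - a" | "2 * \<bar>a + e - 2 * b\<bar> \<le> a - e"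
      by blast
    then show ?thesis
    proof cases
      case 1
      have t2: "0 \<le> t\<^sup>2" "t\<^sup>2 \<le> 1" using assms by (auto simp: abs_square_le_1)
      have eq: "profile Par a b e t = (1 - t\<^sup>2) * b + t\<^sup>2 * e"
        using 1 by (simp add: profile_def field_simps)
      have "(1 - t\<^sup>2) * b + t\<^sup>2 * e \<ge> (1 - t\<^sup>2) * lo + t\<^sup>2 * lo"
        using assms t2 by (intro add_mono mult_left_mono) auto
      moreover have "(1 - t\<^sup>2) * b + t\<^sup>2 * e \<le> (1 - t\<^sup>2) * hi + t\<^sup>2 * hi"
        using assms t2 by (intro add_mono mult_left_mono) auto
      ultimately show ?thesis unfolding Par eq by (simp add: algebra_simps)
    next
      case 2
      then show ?thesis using increasing[OF 2, of t] assms by (simp add: Par profile_def)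
    next
      case 3
      have "profile Par a b e t = profile Par e b a (- t)" by (simp add: profile_reverse)
      then show ?thesis using increasing[OF 3, of "- t"] assms by (simp add: Par profile_def)
    qed
  qed
qed

lemma profile_within_ends:
  assumes "a < b" "b < e" "v \<in> {- d / 2..d / 2}" "d > 0"
  shows "a \<le> profile (edge_type_of a b e) a b e (2 * (v / d)) \<and>
    profile (edge_type_of a b e) a b e (2 * (v / d)) \<le> e"
  using assms by (intro profile_bounds) (auto simp: field_simps)

lemma continuous_on_profile [continuous_intros]:
  "continuous_on A f \<Longrightarrow> continuous_on A (\<lambda>z. profile \<tau> a b e (f z))"
  by (cases \<tau>) (auto simp: profile_def intro!: continuous_intros)

section \<open>Lebesgue integrals in the plane\<close>

lemma has_bochner_integral_lborel_iterated:
  fixes f :: "real \<times> real \<Rightarrow> real"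
  assumes "integrable lborel f"
    and "\<And>x. has_bochner_integral lborel (\<lambda>y. f (x, y)) (g x)"
    and "has_bochner_integral lborel g v"
  shows "has_bochner_integral lborel f v"
proof -
  have int: "integrable (lborel \<Otimes>\<^sub>M lborel) f" using assms(1) by (simp add: lborel_prod)
  have "integral\<^sup>L lborel f = (\<integral>x. \<integral>y. f (x, y) \<partial>lborel \<partial>lborel)"
    using lborel_pair.integral_fst'[OF int] by (simp add: lborel_prod)
  also have "\<dots> = v"
    using has_bochner_integral_integral_eq[OF assms(2)] has_bochner_integral_integral_eq[OF assms(3)]
    by simp
  finally show ?thesis using assms(1) by (simp add: has_bochner_integral_iff)
qed

text \<open>The building blocks of both reconstructions are given for the western side only; this quarter turn
transports their integrals to the other sides. The turn maps boxes to boxes of the same volume, which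
characterises Lebesgue measure.\<close>

lemma has_bochner_integral_rotate:
  fixes f :: "real \<times> real \<Rightarrow> real"
  assumes "has_bochner_integral lborel f v"
  shows "has_bochner_integral lborel (\<lambda>(x, y). f (y, - x)) v"
proof -
  let ?R = "\<lambda>z :: real \<times> real. (snd z, - fst z)"
  have R: "?R \<in> borel_measurable borel"
    by (intro borel_measurable_continuous_onI continuous_intros)
  have "lborel = distr lborel borel ?R"
  proof (rule lborel_eqI)
    fix l u :: "real \<times> real"
    assume lu: "\<And>b. b \<in> Basis \<Longrightarrow> l \<bullet> b \<le> u \<bullet> b"
    obtain l1 l2 u1 u2 where [simp]: "l = (l1, l2)" "u = (u1, u2)" by (cases l; cases u)
    have le: "l1 \<le> u1" "l2 \<le> u2" using lu[of "(1, 0)"] lu[of "(0, 1)"] by (auto simp: Basis_prod_def)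
    have "?R -` box l u \<inter> space lborel = box (- u2, l1) (- l2, u1)"
      by (auto simp: box_def Basis_prod_def)
    then have "emeasure (distr lborel borel ?R) (box l u) = emeasure lborel (box (- u2, l1) (- l2, u1))"
      using R by (subst emeasure_distr) auto
    also have "\<dots> = (\<Prod>b\<in>Basis. (u - l) \<bullet> b)"
      using le by (subst emeasure_lborel_box) (auto simp: Basis_prod_def prod.union_disjoint
         prod.reindex inj_on_def mult.commute image_iff)
    finally show "emeasure (distr lborel borel ?R) (box l u) = (\<Prod>b\<in>Basis. (u - l) \<bullet> b)" .
  qed simp
  then have "has_bochner_integral (distr lborel borel ?R) f v" using assms by simp
  moreover have "f \<in> borel_measurable borel" using assms by (auto simp: has_bochner_integral_iff)
  ultimately have "has_bochner_integral lborel (\<lambda>z. f (?R z)) v"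
    using R integrable_distr_eq[of ?R lborel borel f] integral_distr[of ?R lborel borel f]
    by (simp add: has_bochner_integral_iff)
  then show ?thesis by (simp add: case_prod_beta')
qed

lemma has_bochner_integral_rescale:
  fixes f :: "real \<times> real \<Rightarrow> real"
  assumes "has_bochner_integral lborel f v" "dx > 0" "dy > 0"
  shows "has_bochner_integral lborel (\<lambda>(x, y). f (x / dx, y / dy)) (dx * dy * v)"
proof -
  define c where "c j = fst j / dx + snd j / dy" for j :: "real \<times> real"
  let ?T = "\<lambda>z :: real \<times> real. 0 + (\<Sum>j\<in>Basis. (c j * (z \<bullet> j)) *\<^sub>R j)"
  have T_eq: "?T = (\<lambda>z. (fst z / dx, snd z / dy))"
    by (auto simp: fun_eq_iff Basis_prod_def sum.union_disjoint sum.reindex inj_on_def c_def)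
  have T: "(\<lambda>z. (fst z / dx, snd z / dy)) \<in> borel_measurable (borel :: (real \<times> real) measure)"
    using assms by (intro borel_measurable_continuous_onI continuous_intros) auto
  have "(\<Prod>j\<in>Basis. \<bar>c j\<bar>) = 1 / (dx * dy)"
    using assms by (simp add: Basis_prod_def prod.union_disjoint prod.reindex inj_on_def c_def)
  moreover have "c j \<noteq> 0" if "j \<in> Basis" for j
    using that assms by (auto simp: Basis_prod_def c_def)
  ultimately have eq: "lborel =
      density (distr lborel borel (\<lambda>z. (fst z / dx, snd z / dy))) (\<lambda>_. ennreal (1 / (dx * dy)))"
    using lborel_affine_euclidean[of c 0] unfolding T_eq by simp
  have f: "f \<in> borel_measurable borel" using assms by (auto simp: has_bochner_integral_iff)
  let ?D = "distr lborel borel (\<lambda>z. (fst z / dx, snd z / dy))"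
  have "has_bochner_integral (density ?D (\<lambda>_. ennreal (1 / (dx * dy)))) f v"
    using assms(1) eq by simp
  then have "has_bochner_integral ?D (\<lambda>z. 1 / (dx * dy) * f z) v"
    using f assms integrable_density[of f ?D "\<lambda>_. 1 / (dx * dy)"]
      integral_density[of f ?D "\<lambda>_. 1 / (dx * dy)"]
    unfolding has_bochner_integral_iff by simp
  then have "has_bochner_integral ?D (\<lambda>z. dx * dy * (1 / (dx * dy) * f z)) (dx * dy * v)"
    by (rule has_bochner_integral_mult_right)
  then have "has_bochner_integral ?D f (dx * dy * v)" using assms by simp
  then have "has_bochner_integral lborel (\<lambda>z. f (fst z / dx, snd z / dy)) (dx * dy * v)"
    using T f integrable_distr_eq[of _ lborel borel f] integral_distr[of _ lborel borel f]
    by (force simp: has_bochner_integral_iff)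
  then show ?thesis by (simp add: case_prod_beta')
qed

text \<open>Profiles and the sections of \<open>W_fun\<close> are quadratic on either side of \<open>0\<close>, with a common value
at \<open>0\<close>.\<close>

lemma has_bochner_integral_halfwise_quadratic:
  fixes h :: real
  assumes "0 \<le> h"
  shows "has_bochner_integral lborel
    (\<lambda>t. indicator {-h..h} t * (c0 + c1 * t + c2 * t\<^sup>2
        + (d1 * min t 0 + d2 * (min t 0)\<^sup>2) + (e1 * max t 0 + e2 * (max t 0)\<^sup>2)))
    (2 * h * c0 + 2 * h^3 / 3 * c2 + h\<^sup>2 / 2 * (e1 - d1) + h^3 / 3 * (e2 + d2))"
proof -
  let ?f = "\<lambda>t. c0 + c1 * t + c2 * t\<^sup>2
        + (d1 * min t 0 + d2 * (min t 0)\<^sup>2) + (e1 * max t 0 + e2 * (max t 0)\<^sup>2)"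
  define F where "F c1 c2 t = c0 * t + c1 * t\<^sup>2 / 2 + c2 * t^3 / 3" for c1 c2 t :: real
  have FTC: "((\<lambda>t. c0 + c1 * t + c2 * t\<^sup>2) has_integral F c1 c2 v - F c1 c2 u) {u..v}"
    if "u \<le> v" for c1 c2 u v
    using that unfolding F_def
    by (intro fundamental_theorem_of_calculus)
      (auto intro!: derivative_eq_intros simp flip: has_real_derivative_iff_has_vector_derivative)
  have "(?f has_integral F (c1 + d1) (c2 + d2) 0 - F (c1 + d1) (c2 + d2) (-h)) {-h..0}"
    by (rule has_integral_eq[OF _ FTC]) (use assms in \<open>auto simp: algebra_simps\<close>)
  moreover have "(?f has_integral F (c1 + e1) (c2 + e2) h - F (c1 + e1) (c2 + e2) 0) {0..h}"
    by (rule has_integral_eq[OF _ FTC]) (use assms in \<open>auto simp: algebra_simps\<close>)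
  ultimately have int: "(?f has_integral (F (c1 + d1) (c2 + d2) 0 - F (c1 + d1) (c2 + d2) (-h))
      + (F (c1 + e1) (c2 + e2) h - F (c1 + e1) (c2 + e2) 0)) {-h..h}"
    using assms by (intro has_integral_combine[of "-h" 0 h]) auto
  have "set_integrable lborel {-h..h} ?f"
    by (intro borel_integrable_atLeastAtMost' continuous_intros)
  then have "has_bochner_integral lborel (\<lambda>t. indicator {-h..h} t * ?f t) (integral {-h..h} ?f)"
    using set_borel_integral_eq_integral(2)[of "{-h..h}" ?f]
    by (auto simp: has_bochner_integral_iff set_integrable_def set_lebesgue_integral_def)
  moreover have "integral {-h..h} ?f =
      2 * h * c0 + 2 * h^3 / 3 * c2 + h\<^sup>2 / 2 * (e1 - d1) + h^3 / 3 * (e2 + d2)"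
    using integral_unique[OF int] by (simp add: F_def field_simps power2_eq_square power3_eq_cube)
  ultimately show ?thesis by simp
qed

lemma integrable_continuous_unit_cell:
  fixes f :: "real \<times> real \<Rightarrow> real"
  assumes "continuous_on (cell 1 1) f"
  shows "integrable lborel (\<lambda>z. indicator (cell 1 1) z * f z)"
  using borel_integrable_compact[OF _ assms] by (simp add: cell_def compact_Times)

lemma has_bochner_integral_rotate_cell:
  fixes f :: "real \<times> real \<Rightarrow> real"
  assumes "has_bochner_integral lborel (\<lambda>z. indicator (cell 1 1) z * f z) v"
  shows "has_bochner_integral lborel (\<lambda>z. indicator (cell 1 1) z * f (snd z, - fst z)) v"
proof -
  have "(\<lambda>(x, y). indicator (cell 1 1) (y, - x) * f (y, - x)) = 
      (\<lambda>z. indicator (cell 1 1) z * f (snd z, - fst z))"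
    by (auto simp: fun_eq_iff cell_def indicator_def)
  then show ?thesis using has_bochner_integral_rotate[OF assms] by simp
qed

lemma has_bochner_integral_cell_const:
  "has_bochner_integral lborel (\<lambda>z. indicator (cell 1 1) z * c) (c :: real)"
proof -
  have box: "cell 1 1 = cbox (- 1 / 2, - 1 / 2) (1 / 2, 1 / 2 :: real)"
    by (simp add: cell_def cbox_Pair_eq)
  then have "emeasure lborel (cell 1 1) = 1"
    by (simp add: emeasure_lborel_cbox_eq Basis_prod_def prod.union_disjoint prod.reindex inj_on_def)
  then have "has_bochner_integral lborel (indicator (cell 1 1)) (1 :: real)"
    using has_bochner_integral_real_indicator[of "cell 1 1" lborel] box by (simp add: measure_def)
  from has_bochner_integral_mult_left[OF this, of c] show ?thesis by simp
qed

section \<open>The biparabolic building block\<close>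

text \<open>The next four lemmas give the boundary values of a building block: the full profile on its own edge,
zero on the opposite edge, and on the two adjacent edges the profile that takes the common corner
value and is zero at the other two nodes.\<close>

lemma W_fun_west_edge:
  assumes "-1/2 \<le> Y" "Y \<le> 1/2"
  shows "W_fun s n w a b e (- 1 / 2) Y r = profile w a b e (2 * Y)"
  by (cases s; cases n; cases w; cases "Y < 0")
    (simp_all add: W_fun_def Let_def profile_def power2_eq_square field_simps)

lemma W_fun_east_edge: "W_fun s n w a b e (1 / 2) Y r = 0"
  by (cases s; cases n; cases w; cases "Y < 0")
    (simp_all add: W_fun_def Let_def power2_eq_square field_simps)

lemma W_fun_north_edge: "W_fun s n w a b e X (1 / 2) r = profile n e 0 0 (2 * X)"
  by (cases s; cases n; cases w; cases "X < 0")
    (simp_all add: W_fun_def Let_def profile_def power2_eq_square field_simps)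

lemma W_fun_south_edge: "W_fun s n w a b e X (- 1 / 2) r = profile s a 0 0 (2 * X)"
  by (cases s; cases n; cases w; cases "X < 0")
    (simp_all add: W_fun_def Let_def profile_def power2_eq_square field_simps)

text \<open>The coefficients depend on the position only through the signs of the two coordinates. The flags say
whether \<open>X\<close>, respectively \<open>Y\<close>, is negative; any point of the quadrant represents it.\<close>

definition quadrant_coeffs where
  "quadrant_coeffs s n w a b e r \<sigma> \<rho> =
     W_coeffs s n w a b e (W_centre s n w a b e r) (if \<sigma> then - 1 else 1) (if \<rho> then - 1 else 1)"

text \<open>On the quadrant \<open>X < 0\<close> the function \<open>max X 0\<close> vanishes and \<open>min X 0\<close> is \<open>X\<close>, so a coefficient that
switches at \<open>X = 0\<close> can be moved to one of these two continuous functions, and likewise in \<open>Y\<close>. This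
is possible because the terms with switching coefficients vanish on both coordinate axes. The terms
are grouped by powers in \<open>Y\<close> to fit the one-dimensional integration lemma.\<close>

lemma W_fun_quadrants:
  fixes s n w a b e r
  defines "k4 \<equiv> \<lambda>\<sigma> \<rho>. fst (quadrant_coeffs s n w a b e r \<sigma> \<rho>)"
    and "k5 \<equiv> \<lambda>\<sigma> \<rho>. fst (snd (quadrant_coeffs s n w a b e r \<sigma> \<rho>))"
    and "k7 \<equiv> \<lambda>\<sigma> \<rho>. fst (snd (snd (quadrant_coeffs s n w a b e r \<sigma> \<rho>)))"
    and "k8 \<equiv> \<lambda>\<sigma> \<rho>. snd (snd (snd (quadrant_coeffs s n w a b e r \<sigma> \<rho>)))"
    and "C \<equiv> W_centre s n w a b e r"
  shows "W_fun s n w a b e X Y r =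
    (C - b * X - 2 * (2 * C - b) * X\<^sup>2) + 0 * Y + (- 4 * C) * Y\<^sup>2
    + ((k4 True True * min X 0 + k5 True True * (min X 0)\<^sup>2
        + (k4 False True * max X 0 + k5 False True * (max X 0)\<^sup>2)) * min Y 0
      + (k7 True True * min X 0 + k8 True True * (min X 0)\<^sup>2
        + (k7 False True * max X 0 + k8 False True * (max X 0)\<^sup>2)) * (min Y 0)\<^sup>2)
    + ((k4 True False * min X 0 + k5 True False * (min X 0)\<^sup>2
        + (k4 False False * max X 0 + k5 False False * (max X 0)\<^sup>2)) * max Y 0
      + (k7 True False * min X 0 + k8 True False * (min X 0)\<^sup>2
        + (k7 False False * max X 0 + k8 False False * (max X 0)\<^sup>2)) * (max Y 0)\<^sup>2)"
proof -
  have "W_coeffs s n w a b e C X Y =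
      (k4 (X < 0) (Y < 0), k5 (X < 0) (Y < 0), k7 (X < 0) (Y < 0), k8 (X < 0) (Y < 0))"
    unfolding k4_def k5_def k7_def k8_def quadrant_coeffs_def C_def
    by (cases s; cases n; cases w) auto
  then have "W_fun s n w a b e X Y r = C - b * X - 2 * (2 * C - b) * X\<^sup>2
      + (k4 (X < 0) (Y < 0) * X + k5 (X < 0) (Y < 0) * X\<^sup>2) * Y
      + (- 4 * C + k7 (X < 0) (Y < 0) * X + k8 (X < 0) (Y < 0) * X\<^sup>2) * Y\<^sup>2"
    by (simp add: W_fun_def Let_def C_def)
  then show ?thesis
    by (cases "X < 0"; cases "Y < 0") (simp_all add: algebra_simps)
qed

lemma continuous_on_W_fun [continuous_intros]:
  assumes "continuous_on A f" "continuous_on A g"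
  shows "continuous_on A (\<lambda>z. W_fun s n w a b e (f z) (g z) r)"
  unfolding W_fun_quadrants by (intro continuous_intros assms)

text \<open>Integrating first over \<open>Y\<close> and then over \<open>X\<close> uses the same one-dimensional lemma twice: the inner
integral is again quadratic on either side of \<open>0\<close>. The resulting linear relation between the centre
value and \<open>r\<close> is the defining relation of \<open>W_centre\<close>.\<close>

lemma W_fun_average:
  "has_bochner_integral lborel (\<lambda>z. indicator (cell 1 1) z * W_fun s n w a b e (fst z) (snd z) r) r"
proof (rule has_bochner_integral_lborel_iterated[OF integrable_continuous_unit_cell])
  show "continuous_on (cell 1 1) (\<lambda>z. W_fun s n w a b e (fst z) (snd z) r)"
    by (intro continuous_intros)
  define k4 k5 k7 k8 where "k4 = (\<lambda>\<sigma> \<rho>. fst (quadrant_coeffs s n w a b e r \<sigma> \<rho>))"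
    and "k5 = (\<lambda>\<sigma> \<rho>. fst (snd (quadrant_coeffs s n w a b e r \<sigma> \<rho>)))"
    and "k7 = (\<lambda>\<sigma> \<rho>. fst (snd (snd (quadrant_coeffs s n w a b e r \<sigma> \<rho>))))"
    and "k8 = (\<lambda>\<sigma> \<rho>. snd (snd (snd (quadrant_coeffs s n w a b e r \<sigma> \<rho>))))"
  note k = k4_def k5_def k7_def k8_def
  define C where "C = W_centre s n w a b e r"
  (* The letters d and e refer to the half lines below and above 0, the digits to powers of X;
     1/8 and 1/24 are the first and second moments over a half interval of length 1/2. *)
  define d1 where "d1 = (k4 True False - k4 True True) / 8 + (k7 True False + k7 True True) / 24"
  define d2 where "d2 = (k5 True False - k5 True True) / 8 + (k8 True False + k8 True True) / 24"
  define e1 where "e1 = (k4 False False - k4 False True) / 8 + (k7 False False + k7 False True) / 24"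
  define e2 where "e2 = (k5 False False - k5 False True) / 8 + (k8 False False + k8 False True) / 24"
  define g where "g X = (C - C / 3) + (- b) * X + (- 2 * (2 * C - b)) * X\<^sup>2
      + (d1 * min X 0 + d2 * (min X 0)\<^sup>2) + (e1 * max X 0 + e2 * (max X 0)\<^sup>2)" for X
  have ind: "indicator (cell 1 1) (x, y) = indicator {- (1/2)..1/2} x * (indicator {- (1/2)..1/2} y :: real)"
    for x y by (auto simp: cell_def indicator_def)
  have inner: "has_bochner_integral lborel
      (\<lambda>y. indicator {- (1/2)..1/2} y * W_fun s n w a b e x y r) (g x)" for x
    unfolding W_fun_quadrants C_def[symmetric]
    by (rule back_subst[of "has_bochner_integral lborel _",
          OF has_bochner_integral_halfwise_quadratic[of "1/2"]])
       (simp_all add: g_def d1_def d2_def e1_def e2_def k power2_eq_square power3_eq_cube field_simps)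
  show "has_bochner_integral lborel
      (\<lambda>y. indicator (cell 1 1) (x, y) * W_fun s n w a b e (fst (x, y)) (snd (x, y)) r)
      (indicator {- (1/2)..1/2} x * g x)" for x
    using has_bochner_integral_mult_right[OF inner, of "indicator {- (1/2)..1/2} x" x]
    unfolding ind fst_conv snd_conv mult.assoc[symmetric] by simp
  have "r = 2 * (1/2) * (C - C / 3) + 2 * (1/2)^3 / 3 * (- 2 * (2 * C - b)) + (1/2)\<^sup>2 / 2 * (e1 - d1)
      + (1/2)^3 / 3 * (e2 + d2)"
    unfolding d1_def d2_def e1_def e2_def k C_def quadrant_coeffs_def
    by (cases s; cases n; cases w)
      (simp_all add: W_centre_Hat del: W_centre.simps(5) add: power2_eq_square power3_eq_cube field_simps)
  then show "has_bochner_integral lborel (\<lambda>x. indicator {- (1/2)..1/2} x * g x) r"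
    using has_bochner_integral_halfwise_quadratic[of "1/2" "C - C / 3" "- b" "- 2 * (2 * C - b)" d1 d2 e1 e2]
    unfolding g_def by simp
qed

section \<open>The piecewise-biparabolic reconstruction on the unit cell\<close>

text \<open>On each edge one building block vanishes and the other three superpose. Some of the rotated blocks
traverse the edge against its parametrisation, which \<open>profile_reverse\<close> undoes.\<close>

lemma q_pw_edges:
  assumes "-1/2 \<le> t" "t \<le> 1/2"
  shows "q_pw 1 1 q qbar (- 1 / 2, t) = profile (type_W q) (q SouthWest) (q West) (q NorthWest) (2 * t)"
    and "q_pw 1 1 q qbar (1 / 2, t) = profile (type_E q) (q SouthEast) (q East) (q NorthEast) (2 * t)"
    and "q_pw 1 1 q qbar (t, 1 / 2) = profile (type_N q) (q NorthWest) (q North) (q NorthEast) (2 * t)"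
    and "q_pw 1 1 q qbar (t, - 1 / 2) = profile (type_S q) (q SouthWest) (q South) (q SouthEast) (2 * t)"
proof -
  note W = W_fun_west_edge W_fun_east_edge W_fun_north_edge W_fun_south_edge
  let ?Q = "Q_bar q"
  show "q_pw 1 1 q qbar (- 1 / 2, t) = profile (type_W q) (q SouthWest) (q West) (q NorthWest) (2 * t)"
    unfolding q_pw_def Let_def prod.case
    using W(1)[of t] W(2)[of _ _ _ _ _ _ "-t"] W(3)[of _ _ _ _ _ _ t] W(4)[of _ _ _ _ _ _ "-t"] assms
     profile_superpose[of ?Q "type_W q" "q SouthWest" "q West" "q NorthWest" "2*t"]
    by (simp add: profile_reverse)
  show "q_pw 1 1 q qbar (1 / 2, t) = profile (type_E q) (q SouthEast) (q East) (q NorthEast) (2 * t)"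
    unfolding q_pw_def Let_def prod.case
    using W(2)[of _ _ _ _ _ _ t] W(4)[of _ _ _ _ _ _ t] W(3)[of _ _ _ _ _ _ "-t"] W(1)[of "-t"] assms
     profile_superpose[of ?Q "type_E q" "q SouthEast" "q East" "q NorthEast" "2*t"]
    by (simp add: profile_reverse)
  show "q_pw 1 1 q qbar (t, 1 / 2) = profile (type_N q) (q NorthWest) (q North) (q NorthEast) (2 * t)"
    unfolding q_pw_def Let_def prod.case
    using W(3)[of _ _ _ _ _ _ t] W(4)[of _ _ _ _ _ _ "-t"] W(2)[of _ _ _ _ _ _ "-t"] W(1)[of t] assms
     profile_superpose[of ?Q "type_N q" "q NorthWest" "q North" "q NorthEast" "2*t"]
    by (simp add: profile_reverse)
  show "q_pw 1 1 q qbar (t, - 1 / 2) = profile (type_S q) (q SouthWest) (q South) (q SouthEast) (2 * t)"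
    unfolding q_pw_def Let_def prod.case
    using W(4)[of _ _ _ _ _ _ t] W(3)[of _ _ _ _ _ _ "-t"] W(2)[of _ _ _ _ _ _ "t"] W(1)[of "-t"] assms
     profile_superpose[of ?Q "type_S q" "q SouthWest" "q South" "q SouthEast" "2*t"]
    by (simp add: profile_reverse)
qed

lemma continuous_on_q_pw: "continuous_on A (q_pw 1 1 q qbar)"
  unfolding q_pw_def Let_def case_prod_beta' by (intro continuous_intros) auto

lemma q_pw_average:
  "has_bochner_integral lborel (\<lambda>z. indicator (cell 1 1) z * q_pw 1 1 q qbar z) qbar"
proof -
  let ?Q = "Q_bar q" and ?r = "(qbar - Q_bar q) / 4"
  note W = W_fun_average and R = has_bochner_integral_rotate_cell
  have "has_bochner_integral lborel (\<lambda>z. indicator (cell 1 1) z * ?Q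
     + indicator (cell 1 1) z * W_fun (type_S q) (type_N q) (type_W q)
          ((q SouthWest - ?Q) / 2) (q West - ?Q) ((q NorthWest - ?Q) / 2) (fst z) (snd z) ?r
     + indicator (cell 1 1) z * W_fun (type_E q) (type_W q) (type_S q)
          ((q SouthEast - ?Q) / 2) (q South - ?Q) ((q SouthWest - ?Q) / 2) (snd z) (- fst z) ?r
     + indicator (cell 1 1) z * W_fun (type_W q) (type_E q) (type_N q)
          ((q NorthWest - ?Q) / 2) (q North - ?Q) ((q NorthEast - ?Q) / 2) (- snd z) (fst z) ?r
     + indicator (cell 1 1) z * W_fun (type_N q) (type_S q) (type_E q)
          ((q NorthEast - ?Q) / 2) (q East - ?Q) ((q SouthEast - ?Q) / 2) (- fst z) (- snd z) ?r)
     (?Q + ?r + ?r + ?r + ?r)"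
    using has_bochner_integral_cell_const W R[OF W] R[OF R[OF W]] R[OF R[OF R[OF W]]]
    by (intro has_bochner_integral_add) (simp_all add: case_prod_beta')
  moreover have "?Q + ?r + ?r + ?r + ?r = qbar" by (simp add: field_simps)
  ultimately show ?thesis
    by (simp add: q_pw_def Let_def case_prod_beta' distrib_left)
qed

section \<open>The plateau reconstruction on the unit cell\<close>

text \<open>The interpolation weight \<open>(1 + 2 * X) / (2 * \<eta>)\<close> grows from \<open>0\<close> on the outer edge to \<open>1\<close> on the
plateau, and \<open>- Y / X\<close> is the position on the edge at which the ray from the centre through
\<open>(X, Y)\<close> leaves the cell.\<close>

lemma T_fun_eq_profile:
  assumes "0 < \<eta>" "X < 0"
  shows "T_fun \<tau> \<eta> p a b e X Y =
    p * ((1 + 2 * X) / (2 * \<eta>)) + (1 - (1 + 2 * X) / (2 * \<eta>)) * profile \<tau> a b e (- (Y / X))"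
proof (cases \<tau>)
  case Par
  show ?thesis using assms unfolding Par by (simp add: profile_def power_divide field_simps)
next
  case Hat
  show ?thesis
  proof (cases "Y \<ge> 0")
    case True
    then have "- (Y / X) \<ge> 0" using assms by (simp add: divide_nonneg_neg)
    then show ?thesis using assms True unfolding Hat by (simp add: profile_def field_simps)
  next
    case False
    then have "- (Y / X) \<le> 0" using assms by (simp add: divide_nonpos_neg)
    then show ?thesis using assms False unfolding Hat by (simp add: profile_def field_simps)
  qed
qed

lemma T_fun_diagonal:
  assumes "0 < \<eta>" "X < 0"
  shows "T_fun \<tau> \<eta> p a b e X X = p * ((1 + 2 * X) / (2 * \<eta>)) + (1 - (1 + 2 * X) / (2 * \<eta>)) * a"
    and "T_fun \<tau> \<eta> p a b e X (- X) = p * ((1 + 2 * X) / (2 * \<eta>)) + (1 - (1 + 2 * X) / (2 * \<eta>)) * e"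
  using assms by (simp_all add: T_fun_eq_profile)

lemma T_fun_inner:
  assumes "0 < \<eta>" "\<eta> < 1/2"
  shows "T_fun \<tau> \<eta> p a b e (\<eta> - 1 / 2) Y = p"
  using assms by (subst T_fun_eq_profile) auto

lemma T_fun_outer:
  assumes "0 < \<eta>"
  shows "T_fun \<tau> \<eta> p a b e (- 1 / 2) Y = profile \<tau> a b e (2 * Y)"
  using assms by (subst T_fun_eq_profile) (auto simp: mult.commute)

text \<open>The case distinction in the definition may select another region than the one in question; then the
point lies on the boundary of the plateau or on a diagonal. On a diagonal both adjacent trapezes
interpolate between the plateau value and the same corner value. Opposite trapezes do not meet.\<close>

lemma q_plateau_regions:
  assumes \<eta>: "0 < \<eta>" "\<eta> < 1/2"
  shows "(X, Y) \<in> trapeze \<eta> \<Longrightarrow> q_plateau_at \<eta> p 1 1 q (X, Y) =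
        T_fun (type_W q) \<eta> p (q SouthWest) (q West) (q NorthWest) X Y"
    and "(Y, - X) \<in> trapeze \<eta> \<Longrightarrow> q_plateau_at \<eta> p 1 1 q (X, Y) =
        T_fun (type_S q) \<eta> p (q SouthEast) (q South) (q SouthWest) Y (- X)"
    and "(- Y, X) \<in> trapeze \<eta> \<Longrightarrow> q_plateau_at \<eta> p 1 1 q (X, Y) =
        T_fun (type_N q) \<eta> p (q NorthWest) (q North) (q NorthEast) (- Y) X"
    and "(- X, - Y) \<in> trapeze \<eta> \<Longrightarrow> q_plateau_at \<eta> p 1 1 q (X, Y) =
        T_fun (type_E q) \<eta> p (q NorthEast) (q East) (q SouthEast) (- X) (- Y)"
proof -
  have inner: "x = \<eta> - 1 / 2" if "(x, y) \<in> trapeze \<eta>" "\<bar>x\<bar> \<le> 1 / 2 - \<eta>" for x y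
    using that by (auto simp: trapeze_def)
  have corner: "y = x" if "(x, y) \<in> trapeze \<eta>" "(y, - x) \<in> trapeze \<eta>" for x y
    using that by (auto simp: trapeze_def)
  have opposite: "False" if "(x, y) \<in> trapeze \<eta>" "(- x, - y) \<in> trapeze \<eta>" for x y
    using that \<eta> by (auto simp: trapeze_def)
  have neg: "x < 0" if "(x, y) \<in> trapeze \<eta>" for x y
    using that \<eta> by (auto simp: trapeze_def)
  note unf = q_plateau_at_def Let_def prod.case div_by_1
  note T = T_fun_diagonal[OF \<eta>(1)] T_fun_inner[OF \<eta>]
  show "q_plateau_at \<eta> p 1 1 q (X, Y) =
        T_fun (type_W q) \<eta> p (q SouthWest) (q West) (q NorthWest) X Y" if "(X, Y) \<in> trapeze \<eta>"
    using that inner[OF that] unfolding unf by (auto simp: T simp del: T_fun.simps)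
  show "q_plateau_at \<eta> p 1 1 q (X, Y) =
        T_fun (type_S q) \<eta> p (q SouthEast) (q South) (q SouthWest) Y (- X)" if "(Y, - X) \<in> trapeze \<eta>"
    using that \<eta> inner[OF that] corner[OF _ that] neg[OF that]
    unfolding unf by (auto simp: T simp del: T_fun.simps)
  show "q_plateau_at \<eta> p 1 1 q (X, Y) =
        T_fun (type_N q) \<eta> p (q NorthWest) (q North) (q NorthEast) (- Y) X" if "(- Y, X) \<in> trapeze \<eta>"
  proof -
    have "(Y, - X) \<notin> trapeze \<eta>" using opposite[of Y "-X"] that by auto
    moreover have "X = - Y" if "(X, Y) \<in> trapeze \<eta>" using corner[of "-Y" X] that \<open>(- Y, X) \<in> trapeze \<eta>\<close> by auto
    ultimately show ?thesis
      using that \<eta> inner[OF that] neg[OF that] unfolding unf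
      using T(2)[of "- Y" "type_W q" p "q SouthWest" "q West" "q NorthWest"]
      by (auto simp: T simp del: T_fun.simps)
  qed
  show "q_plateau_at \<eta> p 1 1 q (X, Y) =
        T_fun (type_E q) \<eta> p (q NorthEast) (q East) (q SouthEast) (- X) (- Y)" if "(- X, - Y) \<in> trapeze \<eta>"
  proof -
    have "(X, Y) \<notin> trapeze \<eta>" using opposite[of X Y] that by auto
    moreover have "Y = - X" if "(Y, - X) \<in> trapeze \<eta>" using corner[of Y "-X"] that \<open>(- X, - Y) \<in> trapeze \<eta>\<close> by auto
    moreover have "Y = X" if "(- Y, X) \<in> trapeze \<eta>" using corner[of "-X" "-Y"] that \<open>(- X, - Y) \<in> trapeze \<eta>\<close> by auto
    ultimately show ?thesis
      using that \<eta> inner[OF that] neg[OF that] unfolding unf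
      using T(2)[of "-X" "type_E q" p "q NorthEast" "q East" "q SouthEast"]
        T(1)[of "-X" "type_E q" p "q NorthEast" "q East" "q SouthEast"]
        T(1)[of "-X" "type_S q" p "q SouthEast" "q South" "q SouthWest"]
        T(2)[of "-X" "type_N q" p "q NorthWest" "q North" "q NorthEast"]
      by (auto simp: T simp del: T_fun.simps)
  qed
qed

text \<open>The largest of \<open>- X\<close>, \<open>- Y\<close>, \<open>Y\<close>, \<open>X\<close> decides which of the four trapezes contains a point outside
the plateau.\<close>

lemma cell_cover:
  assumes "(X, Y) \<in> cell 1 1" "0 < \<eta>" "\<eta> < 1/2"
  obtains "\<bar>X\<bar> \<le> 1 / 2 - \<eta>" "\<bar>Y\<bar> \<le> 1 / 2 - \<eta>"
    | "(X, Y) \<in> trapeze \<eta>" | "(Y, - X) \<in> trapeze \<eta>"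
    | "(- Y, X) \<in> trapeze \<eta>" | "(- X, - Y) \<in> trapeze \<eta>"
proof -
  have "\<bar>X\<bar> \<le> 1/2" "\<bar>Y\<bar> \<le> 1/2" using assms by (auto simp: cell_def)
  then show ?thesis using that unfolding trapeze_def mem_Collect_eq prod.case
    by (smt (verit) field_sum_of_halves)
qed

lemma q_plateau_edges:
  assumes \<eta>: "0 < \<eta>" "\<eta> < 1/2" and t: "-1/2 \<le> t" "t \<le> 1/2"
  shows "q_plateau_at \<eta> p 1 1 q (- 1 / 2, t) = profile (type_W q) (q SouthWest) (q West) (q NorthWest) (2 * t)"
    and "q_plateau_at \<eta> p 1 1 q (1 / 2, t) = profile (type_E q) (q SouthEast) (q East) (q NorthEast) (2 * t)"
    and "q_plateau_at \<eta> p 1 1 q (t, 1 / 2) = profile (type_N q) (q NorthWest) (q North) (q NorthEast) (2 * t)"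
    and "q_plateau_at \<eta> p 1 1 q (t, - 1 / 2) = profile (type_S q) (q SouthWest) (q South) (q SouthEast) (2 * t)"
proof -
  note out = T_fun_outer[OF \<eta>(1)]
  have t: "(- 1 / 2, t) \<in> trapeze \<eta>" "(- 1 / 2, - t) \<in> trapeze \<eta>"
    using assms by (auto simp: trapeze_def)
  show "q_plateau_at \<eta> p 1 1 q (- 1 / 2, t) = profile (type_W q) (q SouthWest) (q West) (q NorthWest) (2 * t)"
    using q_plateau_regions(1)[OF \<eta>, of "-1/2" t p q] t out[of _ p _ _ _ "t"]
    by (simp del: T_fun.simps)
  show "q_plateau_at \<eta> p 1 1 q (1 / 2, t) = profile (type_E q) (q SouthEast) (q East) (q NorthEast) (2 * t)"
    using q_plateau_regions(4)[OF \<eta>, of "1/2" t p q] t out[of _ p _ _ _ "-t"]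
    by (simp add: profile_reverse del: T_fun.simps)
  show "q_plateau_at \<eta> p 1 1 q (t, 1 / 2) = profile (type_N q) (q NorthWest) (q North) (q NorthEast) (2 * t)"
    using q_plateau_regions(3)[OF \<eta>, of "1/2" t p q] t out[of _ p _ _ _ "t"]
    by (simp add: profile_reverse del: T_fun.simps)
  show "q_plateau_at \<eta> p 1 1 q (t, - 1 / 2) = profile (type_S q) (q SouthWest) (q South) (q SouthEast) (2 * t)"
    using q_plateau_regions(2)[OF \<eta>, of "-1/2" t p q] t out[of _ p _ _ _ "-t"]
    by (simp add: profile_reverse del: T_fun.simps)
qed

lemma T_fun_bounds:
  assumes "0 < \<eta>" "\<eta> < 1/2" "(X, Y) \<in> trapeze \<eta>" "\<tau> = edge_type_of a b e"
    and "lo \<le> p" "p \<le> hi" "lo \<le> a" "lo \<le> b" "lo \<le> e" "a \<le> hi" "b \<le> hi" "e \<le> hi"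
  shows "lo \<le> T_fun \<tau> \<eta> p a b e X Y \<and> T_fun \<tau> \<eta> p a b e X Y \<le> hi"
proof -
  have X: "X < 0" "- 1/2 \<le> X" "X \<le> - 1/2 + \<eta>" "X \<le> Y" "Y \<le> - X"
    using assms by (auto simp: trapeze_def)
  define s where "s = (1 + 2 * X) / (2 * \<eta>)"
  have s: "0 \<le> s" "s \<le> 1" using X assms by (auto simp: s_def field_simps)
  have t: "-1 \<le> - (Y / X)" "- (Y / X) \<le> 1" using X by (auto simp: field_simps)
  have pr: "lo \<le> profile \<tau> a b e (- (Y / X))" "profile \<tau> a b e (- (Y / X)) \<le> hi"
    using profile_bounds[OF assms(7-12) t] assms(4) by auto
  have "p * s + (1 - s) * profile \<tau> a b e (- (Y / X)) \<ge> lo * s + (1 - s) * lo"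
    using assms s pr by (intro add_mono mult_left_mono mult_right_mono) auto
  moreover have "p * s + (1 - s) * profile \<tau> a b e (- (Y / X)) \<le> hi * s + (1 - s) * hi"
    using assms s pr by (intro add_mono mult_left_mono mult_right_mono) auto
  ultimately show ?thesis
    unfolding T_fun_eq_profile[OF assms(1) X(1)] s_def[symmetric] by (simp add: algebra_simps)
qed

lemma q_plateau_bounds:
  assumes \<eta>: "0 < \<eta>" "\<eta> < 1/2" and z: "z \<in> cell 1 1"
    and "lo \<le> p" "p \<le> hi" and q: "\<And>l. lo \<le> q l" "\<And>l. q l \<le> hi"
  shows "lo \<le> q_plateau_at \<eta> p 1 1 q z \<and> q_plateau_at \<eta> p 1 1 q z \<le> hi"
proof -
  obtain X Y where [simp]: "z = (X, Y)" by (cases z)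
  note B = T_fun_bounds[OF \<eta> _ _ assms(4,5) q(1,1,1) q(2,2,2)] and R = q_plateau_regions[OF \<eta>, of _ _ p q]
  from z have "(X, Y) \<in> cell 1 1" by simp
  from this \<eta> show ?thesis
  proof (cases rule: cell_cover)
    case 1
    then show ?thesis using assms by (simp add: q_plateau_at_def)
  next
    case 2
    then show ?thesis using B[OF 2] R(1)[OF 2] by (simp add: type_W_def del: T_fun.simps)
  next
    case 3
    then show ?thesis using B[OF 3] R(2)[OF 3] edge_type_of_commute
      by (simp add: type_S_def del: T_fun.simps)
  next
    case 4
    then show ?thesis using B[OF 4] R(3)[OF 4] by (simp add: type_N_def del: T_fun.simps)
  next
    case 5
    then show ?thesis using B[OF 5] R(4)[OF 5] edge_type_of_commute
      by (simp add: type_E_def del: T_fun.simps)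
  qed
qed

lemma continuous_on_T_fun:
  assumes "0 < \<eta>" "\<eta> < 1/2" "continuous_on A f" "continuous_on A g"
    "\<And>z. z \<in> A \<Longrightarrow> (f z, g z) \<in> trapeze \<eta>"
  shows "continuous_on A (\<lambda>z. T_fun \<tau> \<eta> p a b e (f z) (g z))"
proof -
  have neg: "f z < 0" if "z \<in> A" for z using assms(5)[OF that] assms(1,2) by (auto simp: trapeze_def)
  have "continuous_on A (\<lambda>z. p * ((1 + 2 * f z) / (2 * \<eta>))
      + (1 - (1 + 2 * f z) / (2 * \<eta>)) * profile \<tau> a b e (- (g z / f z)))"
    using assms(1) neg by (intro continuous_intros assms(3,4)) force+
  then show ?thesis
    using T_fun_eq_profile[OF assms(1) neg] by (simp cong: continuous_on_cong del: T_fun.simps)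
qed

lemma closed_trapeze_vimage:
  fixes f g :: "real \<times> real \<Rightarrow> real"
  assumes "continuous_on UNIV f" "continuous_on UNIV g"
  shows "closed {z. (f z, g z) \<in> trapeze \<eta>}"
  unfolding trapeze_def mem_Collect_eq prod.case
  by (intro closed_Collect_conj closed_Collect_le continuous_intros assms)

text \<open>The five closed regions are pasted together; on each of them the function is given by one formula.\<close>

lemma continuous_on_q_plateau:
  assumes \<eta>: "0 < \<eta>" "\<eta> < 1/2"
  shows "continuous_on (cell 1 1) (q_plateau_at \<eta> p 1 1 q)"
proof -
  let ?U = "q_plateau_at \<eta> p 1 1 q"
  let ?P = "{z :: real \<times> real. \<bar>fst z\<bar> \<le> 1 / 2 - \<eta> \<and> \<bar>snd z\<bar> \<le> 1 / 2 - \<eta>}"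
  let ?W = "{z :: real \<times> real. (fst z, snd z) \<in> trapeze \<eta>}"
  let ?S = "{z :: real \<times> real. (snd z, - fst z) \<in> trapeze \<eta>}"
  let ?N = "{z :: real \<times> real. (- snd z, fst z) \<in> trapeze \<eta>}"
  let ?E = "{z :: real \<times> real. (- fst z, - snd z) \<in> trapeze \<eta>}"
  note R = q_plateau_regions[OF \<eta>, where X = "fst z" and Y = "snd z" and p = p and q = q for z,
      unfolded prod.collapse]
  have "continuous_on ?P ?U"
    by (rule continuous_on_eq[of _ "\<lambda>_. p"]) (auto simp: q_plateau_at_def)
  moreover have "continuous_on ?W ?U"
    by (rule continuous_on_eq[OF continuous_on_T_fun[OF \<eta>, of _ "fst" "snd"] R(1)[symmetric]]) (auto intro!: continuous_intros)
  moreover have "continuous_on ?S ?U"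
    by (rule continuous_on_eq[OF continuous_on_T_fun[OF \<eta>, of _ "snd" "\<lambda>z. - fst z"] R(2)[symmetric]]) (auto intro!: continuous_intros)
  moreover have "continuous_on ?N ?U"
    by (rule continuous_on_eq[OF continuous_on_T_fun[OF \<eta>, of _ "\<lambda>z. - snd z" "fst"] R(3)[symmetric]]) (auto intro!: continuous_intros)
  moreover have "continuous_on ?E ?U"
    by (rule continuous_on_eq[OF continuous_on_T_fun[OF \<eta>, of _ "\<lambda>z. - fst z" "\<lambda>z. - snd z"] R(4)[symmetric]]) (auto intro!: continuous_intros)
  moreover have "closed ?P"
    by (intro closed_Collect_conj closed_Collect_le continuous_intros)
  ultimately have "continuous_on (?P \<union> (?W \<union> (?S \<union> (?N \<union> ?E)))) ?U"
    by (intro continuous_on_closed_Un closed_Un closed_trapeze_vimage continuous_intros)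
  then show ?thesis
    by (rule continuous_on_subset) (auto elim!: cell_cover[OF _ \<eta>])
qed

section \<open>The average of the plateau reconstruction\<close>

text \<open>This is \<open>edge_mean\<close> with the type as an independent argument, so that it can be computed without
reference to where the type comes from.\<close>

definition profile_mean :: "edge_type \<Rightarrow> real \<Rightarrow> real \<Rightarrow> real \<Rightarrow> real" where
  "profile_mean \<tau> a b e = (case \<tau> of Par \<Rightarrow> (a + 4 * b + e) / 6 | Hat \<Rightarrow> (a + 2 * b + e) / 4)"

lemma has_bochner_integral_profile:
  "has_bochner_integral lborel (\<lambda>t. indicator {-1..1} t * profile \<tau> a b e t) (2 * profile_mean \<tau> a b e)"
proof (cases \<tau>)
  case Par
  show ?thesis
    using has_bochner_integral_halfwise_quadratic[of 1 b "(e - a) / 2" "(e + a - 2 * b) / 2" 0 0 0 0]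
    unfolding Par by (simp add: profile_def profile_mean_def field_simps)
next
  case Hat
  have "2 * profile_mean Hat a b e = 2 * b + (e - b - (b - a)) / 2"
    by (simp add: profile_mean_def field_simps)
  then show ?thesis
    using has_bochner_integral_halfwise_quadratic[of 1 b 0 0 "b - a" 0 "e - b" 0]
    unfolding Hat by (simp add: profile_def)
qed

text \<open>The western trapeze without its upper diagonal side. Each of the four rotated copies owns one of
the two diagonals bounding it, so that the copies are disjoint and decompositions of functions hold
pointwise rather than almost everywhere.\<close>

definition pinwheel :: "real \<Rightarrow> (real \<times> real) set" where
  "pinwheel \<eta> = {(X, Y). - 1 / 2 \<le> X \<and> X \<le> - 1 / 2 + \<eta> \<and> X \<le> Y \<and> Y < - X}"

lemma pinwheel_subset: "pinwheel \<eta> \<subseteq> trapeze \<eta>"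
  by (auto simp: pinwheel_def trapeze_def)

definition deviation :: "edge_type \<Rightarrow> real \<Rightarrow> real \<Rightarrow> real \<Rightarrow> real \<Rightarrow> real \<Rightarrow> real \<times> real \<Rightarrow> real" where
  "deviation \<tau> \<eta> p a b e =
    (\<lambda>(X, Y). indicator (pinwheel \<eta>) (X, Y) * (T_fun \<tau> \<eta> p a b e X Y - p))"

lemma integrable_deviation:
  assumes \<eta>: "0 < \<eta>" "\<eta> < 1/2"
  shows "integrable lborel (deviation \<tau> \<eta> p a b e)"
proof -
  let ?f = "\<lambda>z. T_fun \<tau> \<eta> p a b e (fst z) (snd z) - p"
  have clo: "closed (trapeze \<eta>)" using closed_trapeze_vimage[of fst snd \<eta>] by (simp add: continuous_intros)
  have "trapeze \<eta> \<subseteq> cell 1 1" using \<eta> by (auto simp: trapeze_def cell_def)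
  moreover have "compact (cell 1 1)" by (simp add: cell_def compact_Times)
  ultimately have com: "compact (trapeze \<eta>)" using clo by (metis compact_Int_closed inf.absorb_iff2)
  have cont: "continuous_on (trapeze \<eta>) ?f"
    by (intro continuous_intros continuous_on_T_fun[OF \<eta>]) auto
  have int: "set_integrable lborel (trapeze \<eta>) ?f"
    using borel_integrable_compact[OF com cont] by (simp add: set_integrable_def)
  have "pinwheel \<eta> = trapeze \<eta> - {z. - fst z \<le> snd z}"
    by (auto simp: pinwheel_def trapeze_def)
  moreover have "closed {z :: real \<times> real. - fst z \<le> snd z}"
    by (intro closed_Collect_le continuous_intros)
  ultimately have "pinwheel \<eta> \<in> sets lborel" using clo by auto
  then have "set_integrable lborel (pinwheel \<eta>) ?f"
    using set_integrable_subset[OF int] pinwheel_subset by blast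
  then show ?thesis by (simp add: set_integrable_def deviation_def case_prod_beta')
qed

text \<open>On a vertical section the substitution \<open>y = - x t\<close> turns the ray coordinate \<open>- y / x\<close> into \<open>t\<close>, so the
inner integral is the mean deviation of the profile from \<open>p\<close>, times the length \<open>- 2 x\<close> of the section,
times the interpolation weight, which is constant on the section. What remains is an integral of a quadratic polynomial in \<open>x\<close>.\<close>

lemma deviation_integral:
  assumes \<eta>: "0 < \<eta>" "\<eta> < 1/2"
  shows "has_bochner_integral lborel (deviation \<tau> \<eta> p a b e)
    (\<eta> * (3 - 2 * \<eta>) / 6 * (profile_mean \<tau> a b e - p))"
proof (rule has_bochner_integral_lborel_iterated[OF integrable_deviation[OF \<eta>]])
  let ?\<mu> = "profile_mean \<tau> a b e"
  (* The inner integral over the section at X. *)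
  define w where "w X = (1 - (1 + 2 * X) / (2 * \<eta>)) * (- X) * (2 * (?\<mu> - p))" for X
  let ?I = "{- 1/2..- 1/2 + \<eta>}"
  let ?b = "\<lambda>t. indicator {-1..<1} t * (profile \<tau> a b e t - p)"
  have "has_bochner_integral lborel (\<lambda>t :: real. indicator {-1..1} t * p) (2 * p)"
    using has_bochner_integral_halfwise_quadratic[of 1 p 0 0 0 0 0 0] by simp
  from has_bochner_integral_diff[OF has_bochner_integral_profile this]
  have "has_bochner_integral lborel
      (\<lambda>t. indicator {-1..1} t * profile \<tau> a b e t - indicator {-1..1} t * p) (2 * (?\<mu> - p))"
    by (simp add: algebra_simps)
  moreover have "AE t in lborel. indicator {-1..1} t * profile \<tau> a b e t - indicator {-1..1} t * p = ?b t"
    using AE_lborel_singleton[of "1 :: real"] by eventually_elim (auto simp: indicator_def)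
  moreover have "?b \<in> borel_measurable lborel"
    using borel_measurable_continuous_onI[OF continuous_on_profile[OF continuous_on_id, of UNIV \<tau> a b e]]
    by auto
  ultimately have base: "has_bochner_integral lborel ?b (2 * (?\<mu> - p))"
    by (blast intro: has_bochner_integralI_AE)
  show "has_bochner_integral lborel (\<lambda>y. deviation \<tau> \<eta> p a b e (x, y)) (w x * indicator ?I x)" for x
  proof (cases "x \<in> ?I")
    case False
    then show ?thesis by (auto simp: deviation_def pinwheel_def)
  next
    case True
    then have x: "x < 0" using \<eta> by auto
    have "has_bochner_integral lborel (\<lambda>y. ?b (0 + (- 1 / x) * y)) (2 * (?\<mu> - p) /\<^sub>R \<bar>- 1 / x\<bar>)"
      using base x by (subst (asm) lborel_has_bochner_integral_real_affine_iff[of "- 1 / x" _ _ 0]) auto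
    then have "has_bochner_integral lborel
        (\<lambda>y. (1 - (1 + 2 * x) / (2 * \<eta>)) * ?b (- (y / x))) (w x)"
      using x has_bochner_integral_mult_right[of "1 - (1 + 2 * x) / (2 * \<eta>)"
        lborel "\<lambda>y. ?b (0 + (- 1 / x) * y)" "2 * (?\<mu> - p) /\<^sub>R \<bar>- 1 / x\<bar>"]
      by (simp add: w_def mult_ac)
    moreover have "(1 - (1 + 2 * x) / (2 * \<eta>)) * ?b (- (y / x)) = deviation \<tau> \<eta> p a b e (x, y)" for y
    proof -
      have "- (y / x) \<in> {-1..<1} \<longleftrightarrow> (x, y) \<in> pinwheel \<eta>"
        using x True by (auto simp: pinwheel_def field_simps)
      then show ?thesis
        unfolding deviation_def prod.case T_fun_eq_profile[OF \<eta>(1) x]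
        by (auto simp: indicator_def algebra_simps)
    qed
    ultimately show ?thesis using True by simp
  qed
  define F where "F X = - 2 * (?\<mu> - p) * (X\<^sup>2 / 2 - (X\<^sup>2 / 2 + 2 * X^3 / 3) / (2 * \<eta>))" for X
  have "has_bochner_integral lborel (\<lambda>x. w x * indicator ?I x) (F (- 1/2 + \<eta>) - F (- 1/2))"
    using \<eta> unfolding F_def w_def
    by (intro has_bochner_integral_FTC_Icc_real)
      (auto intro!: derivative_eq_intros continuous_intros simp: field_simps power2_eq_square)
  moreover have "F (- 1/2 + \<eta>) - F (- 1/2) = \<eta> * (3 - 2 * \<eta>) / 6 * (?\<mu> - p)"
    using \<eta> unfolding F_def by (simp add: field_simps power2_eq_square power3_eq_cube)
  ultimately show "has_bochner_integral lborel (\<lambda>x. w x * indicator ?I x)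
      (\<eta> * (3 - 2 * \<eta>) / 6 * (?\<mu> - p))" by (simp only:)
qed

text \<open>Away from the four disjoint copies of \<open>pinwheel\<close> the reconstruction equals \<open>p\<close>, so that its integral
splits into four integrals over congruent sets.\<close>

lemma q_plateau_pinwheel:
  assumes \<eta>: "0 < \<eta>" "\<eta> < 1/2"
  shows "indicator (cell 1 1) z * q_plateau_at \<eta> p 1 1 q z = indicator (cell 1 1) z * p
    + deviation (type_W q) \<eta> p (q SouthWest) (q West) (q NorthWest) z
    + deviation (type_S q) \<eta> p (q SouthEast) (q South) (q SouthWest) (snd z, - fst z)
    + deviation (type_N q) \<eta> p (q NorthWest) (q North) (q NorthEast) (- snd z, fst z)
    + deviation (type_E q) \<eta> p (q NorthEast) (q East) (q SouthEast) (- fst z, - snd z)"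
proof -
  obtain X Y where [simp]: "z = (X, Y)" by (cases z)
  note R = q_plateau_regions[OF \<eta>, of _ _ p q]
  have disjoint: "(Y, - X) \<notin> pinwheel \<eta>" "(- Y, X) \<notin> pinwheel \<eta>" "(- X, - Y) \<notin> pinwheel \<eta>"
    if "(X, Y) \<in> pinwheel \<eta>" for X Y
    using that \<eta> by (auto simp: pinwheel_def)
  have in_cell: "(X, Y) \<in> cell 1 1" if "(X, Y) \<in> pinwheel \<eta>" for X Y
    using that \<eta> by (auto simp: pinwheel_def cell_def)
  consider "(X, Y) \<in> pinwheel \<eta>" | "(Y, - X) \<in> pinwheel \<eta>"
    | "(- Y, X) \<in> pinwheel \<eta>" | "(- X, - Y) \<in> pinwheel \<eta>"
    | (none) "(X, Y) \<notin> pinwheel \<eta>" "(Y, - X) \<notin> pinwheel \<eta>"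
        "(- Y, X) \<notin> pinwheel \<eta>" "(- X, - Y) \<notin> pinwheel \<eta>"
    by blast
  then show ?thesis
  proof cases
    case 1
    then show ?thesis
      using R(1)[of X Y] disjoint[OF 1] in_cell[OF 1] pinwheel_subset[of \<eta>]
      by (auto simp: deviation_def simp del: T_fun.simps)
  next
    case 2
    then show ?thesis
      using R(2)[of Y X] disjoint[OF 2] in_cell[OF 2] pinwheel_subset[of \<eta>]
      by (auto simp: deviation_def cell_def simp del: T_fun.simps)
  next
    case 3
    then show ?thesis
      using R(3)[of Y X] disjoint[OF 3] in_cell[OF 3] pinwheel_subset[of \<eta>]
      by (auto simp: deviation_def cell_def simp del: T_fun.simps)
  next
    case 4
    then show ?thesis
      using R(4)[of X Y] disjoint[OF 4] in_cell[OF 4] pinwheel_subset[of \<eta>]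
      by (auto simp: deviation_def cell_def simp del: T_fun.simps)
  next
    case none
    have "q_plateau_at \<eta> p 1 1 q (X, Y) = p" if "(X, Y) \<in> cell 1 1"
    proof -
      have "\<bar>X\<bar> \<le> 1/2" "\<bar>Y\<bar> \<le> 1/2" using that by (auto simp: cell_def)
      then have "\<bar>X\<bar> \<le> 1 / 2 - \<eta>" "\<bar>Y\<bar> \<le> 1 / 2 - \<eta>"
        using none \<eta> unfolding pinwheel_def mem_Collect_eq prod.case
        by (smt (verit) field_sum_of_halves)+
      then show ?thesis by (simp add: q_plateau_at_def)
    qed
    then show ?thesis using none by (auto simp: deviation_def indicator_def)
  qed
qed

lemma q_plateau_average:
  assumes \<eta>: "0 < \<eta>" "\<eta> < 1/2"
  shows "has_bochner_integral lborel (\<lambda>z. indicator (cell 1 1) z * q_plateau_at \<eta> p 1 1 q z)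
    (p + \<eta> * (3 - 2 * \<eta>) / 6 * (edge_mean_sum q - 4 * p))"
proof -
  let ?k = "\<eta> * (3 - 2 * \<eta>) / 6"
  note D = deviation_integral[OF \<eta>] and R = has_bochner_integral_rotate
  have "has_bochner_integral lborel (\<lambda>z. indicator (cell 1 1) z * p
      + deviation (type_W q) \<eta> p (q SouthWest) (q West) (q NorthWest) z
      + deviation (type_S q) \<eta> p (q SouthEast) (q South) (q SouthWest) (snd z, - fst z)
      + deviation (type_N q) \<eta> p (q NorthWest) (q North) (q NorthEast) (- snd z, fst z)
      + deviation (type_E q) \<eta> p (q NorthEast) (q East) (q SouthEast) (- fst z, - snd z))
     (p + ?k * (profile_mean (type_W q) (q SouthWest) (q West) (q NorthWest) - p)
        + ?k * (profile_mean (type_S q) (q SouthEast) (q South) (q SouthWest) - p)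
        + ?k * (profile_mean (type_N q) (q NorthWest) (q North) (q NorthEast) - p)
        + ?k * (profile_mean (type_E q) (q NorthEast) (q East) (q SouthEast) - p))"
    using has_bochner_integral_cell_const D R[OF D] R[OF R[OF D]] R[OF R[OF R[OF D]]]
    by (intro has_bochner_integral_add) (simp_all add: case_prod_beta')
  moreover have "profile_mean \<tau> a b e = profile_mean \<tau> e b a" for \<tau> a b e
    by (cases \<tau>) (simp_all add: profile_mean_def)
  then have "edge_mean_sum q = profile_mean (type_W q) (q SouthWest) (q West) (q NorthWest)
      + profile_mean (type_S q) (q SouthEast) (q South) (q SouthWest)
      + profile_mean (type_N q) (q NorthWest) (q North) (q NorthEast)
      + profile_mean (type_E q) (q NorthEast) (q East) (q SouthEast)"
    by (simp add: edge_mean_sum_def edge_mean_def type_W_def type_S_def type_N_def type_E_def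
        profile_mean_def)
  then have "p + ?k * (profile_mean (type_W q) (q SouthWest) (q West) (q NorthWest) - p)
        + ?k * (profile_mean (type_S q) (q SouthEast) (q South) (q SouthWest) - p)
        + ?k * (profile_mean (type_N q) (q NorthWest) (q North) (q NorthEast) - p)
        + ?k * (profile_mean (type_E q) (q NorthEast) (q East) (q SouthEast) - p)
      = p + ?k * (edge_mean_sum q - 4 * p)"
    by algebra
  ultimately show ?thesis
    unfolding q_plateau_pinwheel[OF \<eta>] by (simp only:)
qed

section \<open>The plateau parameters\<close>

lemma edge_mean_bounds:
  assumes "lo \<le> a" "lo \<le> b" "lo \<le> e" "a \<le> hi" "b \<le> hi" "e \<le> hi"
  shows "lo \<le> edge_mean a b e \<and> edge_mean a b e \<le> hi"
  using assms by (cases "edge_type_of a b e") (auto simp: edge_mean_def)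

lemma edge_mean_sum_bounds:
  assumes "\<And>l. lo \<le> q l" "\<And>l. q l \<le> hi"
  shows "4 * lo \<le> edge_mean_sum q \<and> edge_mean_sum q \<le> 4 * hi"
proof -
  have "lo \<le> edge_mean (q i) (q j) (q k) \<and> edge_mean (q i) (q j) (q k) \<le> hi" for i j k
    using assms by (intro edge_mean_bounds)
  note B = this
  show ?thesis unfolding edge_mean_sum_def
    using B[of NorthWest North NorthEast] B[of SouthWest South SouthEast]
      B[of SouthWest West NorthWest] B[of SouthEast East NorthEast] by linarith
qed

lemma q_min_le: "q_min q \<le> q l" and q_max_ge: "q l \<le> q_max q"
proof -
  have "finite (UNIV :: location set)" by (subst UNIV_location) blast
  then have "finite (range q)" by (rule finite_imageI)
  then show "q_min q \<le> q l" "q l \<le> q_max q" unfolding q_min_def q_max_def by simp_all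
qed

lemma plateau_denominator_pos: "(6 :: real) - 12 * \<eta> + 8 * \<eta>\<^sup>2 > 0"
proof -
  have "6 - 12 * \<eta> + 8 * \<eta>\<^sup>2 = 8 * (\<eta> - 3 / 4)\<^sup>2 + 3 / 2"
    by (simp add: power2_eq_square algebra_simps)
  then show ?thesis by (simp add: add_nonneg_pos)
qed

lemma plateau_value_reflect: "plateau_value q qbar (3 / 2 - \<eta>) = plateau_value q qbar \<eta>"
proof -
  have "(3 / 2 - \<eta>) * (3 - 2 * (3 / 2 - \<eta>)) = \<eta> * (3 - 2 * \<eta>)"
    "6 - 12 * (3 / 2 - \<eta>) + 8 * (3 / 2 - \<eta>)\<^sup>2 = 6 - 12 * \<eta> + 8 * \<eta>\<^sup>2"
    by (simp_all add: power2_eq_square algebra_simps)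
  then show ?thesis by (simp only: plateau_value_def)
qed

text \<open>With \<open>t = \<eta> (2 \<eta> - 3) \<ge> 0\<close> the value is \<open>(6 qbar + 4 t (\<Sigma> / 4)) / (6 + 4 t)\<close>, a weighted mean in
which \<open>qbar\<close> has positive weight.\<close>

lemma plateau_value_beyond:
  assumes m: "q_min q < qbar" "qbar < q_max q" and "\<eta> \<ge> 3 / 2"
  shows "q_min q < plateau_value q qbar \<eta> \<and> plateau_value q qbar \<eta> < q_max q"
proof -
  define t where "t = \<eta> * (2 * \<eta> - 3)"
  have t: "t \<ge> 0" using assms by (simp add: t_def)
  have S: "4 * q_min q \<le> edge_mean_sum q" "edge_mean_sum q \<le> 4 * q_max q"
    using edge_mean_sum_bounds[of "q_min q" q "q_max q"] q_min_le q_max_ge by auto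
  have eq: "plateau_value q qbar \<eta> = (6 * qbar + t * edge_mean_sum q) / (6 + 4 * t)"
    unfolding plateau_value_def t_def
    by (rule arg_cong2[of _ _ _ _ "(/)"]) (simp_all add: power2_eq_square algebra_simps)
  have "t * (4 * q_min q) \<le> t * edge_mean_sum q" "t * edge_mean_sum q \<le> t * (4 * q_max q)"
    using t S by (auto intro: mult_left_mono)
  then show ?thesis using m t unfolding eq by (simp add: field_simps)
qed

lemma continuous_on_plateau_value: "continuous_on A (plateau_value q qbar)"
proof -
  have "6 - 12 * \<eta> + 8 * \<eta>\<^sup>2 \<noteq> 0" for \<eta> :: real using plateau_denominator_pos[of \<eta>] by linarith
  then show ?thesis unfolding plateau_value_def by (intro continuous_intros) auto
qed

lemma plateau_value_0: "plateau_value q qbar 0 = qbar"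
  by (simp add: plateau_value_def)

text \<open>A positive solution \<open>x\<close> is below \<open>3 / 2\<close> by \<open>plateau_value_beyond\<close>, and by symmetry \<open>3 / 2 - x\<close> is a
solution as well, so there is one in \<open>(0, 3 / 4]\<close>. The solutions up to that one form a compact set, as
\<open>0\<close> is not a solution, hence have a least element.\<close>

lemma plateau_parameters:
  assumes m: "q_min q < qbar" "qbar < q_max q"
  defines "\<eta> \<equiv> plateau_eta q qbar"
  shows "0 < \<eta>" "\<eta> < 1 / 2"
    "q_min q < plateau_value q qbar \<eta>" "plateau_value q qbar \<eta> < q_max q"
proof -
  let ?v = "plateau_value q qbar"
  define sol where "sol x \<longleftrightarrow> x > 0 \<and> (?v x = q_min q \<or> ?v x = q_max q)" for x
  have \<eta>_eq: "\<eta> = (if \<exists>x. sol x then (LEAST x. sol x) / 2 else 1 / 4)"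
    unfolding \<eta>_def plateau_eta_def sol_def Let_def ..
  have between: "q_min q < ?v x \<and> ?v x < q_max q" if "0 \<le> x" "\<And>y. 0 < y \<Longrightarrow> y \<le> x \<Longrightarrow> \<not> sol y" for x
  proof (rule ccontr)
    assume "\<not> ?thesis"
    then consider "?v x \<le> q_min q" | "?v x \<ge> q_max q" by linarith
    then show False
    proof cases
      case 1
      then have "\<exists>y. 0 \<le> y \<and> y \<le> x \<and> ?v y = q_min q"
        using IVT2'[of ?v x "q_min q" 0] continuous_on_plateau_value \<open>0 \<le> x\<close> m
        by (fastforce simp: plateau_value_0)
      then obtain y where "0 \<le> y" "y \<le> x" "?v y = q_min q" by blast
      moreover from this have "y \<noteq> 0" using m by (auto simp: plateau_value_0)
      ultimately show False using that(2)[of y] by (auto simp: sol_def)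
    next
      case 2
      then have "\<exists>y. 0 \<le> y \<and> y \<le> x \<and> ?v y = q_max q"
        using IVT'[of ?v 0 "q_max q" x] continuous_on_plateau_value \<open>0 \<le> x\<close> m
        by (fastforce simp: plateau_value_0)
      then obtain y where "0 \<le> y" "y \<le> x" "?v y = q_max q" by blast
      moreover from this have "y \<noteq> 0" using m by (auto simp: plateau_value_0)
      ultimately show False using that(2)[of y] by (auto simp: sol_def)
    qed
  qed
  have "0 < \<eta> \<and> \<eta> < 1 / 2 \<and> (\<forall>y. 0 < y \<longrightarrow> y \<le> \<eta> \<longrightarrow> \<not> sol y)"
  proof (cases "\<exists>x. sol x")
    case False
    then show ?thesis by (simp add: \<eta>_eq)
  next
    case True
    then obtain x where x: "sol x" by blast
    (* The smaller one of the two solutions that are exchanged by the reflection at 3/4. *)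
    define x' where "x' = min x (3 / 2 - x)"
    have "x < 3 / 2"
      using plateau_value_beyond[OF m, of x] x by (force simp: sol_def)
    then have x': "sol x'" "x' \<le> 3 / 4"
      using x by (auto simp: sol_def x'_def min_def plateau_value_reflect)
    define K where "K = {0..x'} \<inter> ?v -` {q_min q, q_max q}"
    have "closed K"
      unfolding K_def by (intro continuous_closed_preimage continuous_on_plateau_value) auto
    moreover have "K \<subseteq> {0..x'}" by (auto simp: K_def)
    ultimately have "compact K" by (metis compact_Icc compact_Int_closed inf.absorb_iff2)
    moreover have "x' \<in> K" using x' by (auto simp: K_def sol_def)
    ultimately obtain x0 where x0: "x0 \<in> K" "\<And>y. y \<in> K \<Longrightarrow> x0 \<le> y"
      using compact_attains_inf[of K] by blast
    have "x0 \<noteq> 0" using x0(1) m by (auto simp: K_def plateau_value_0)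
    then have sol0: "sol x0" "x0 \<le> x'" using x0(1) by (auto simp: K_def sol_def)
    have least: "x0 \<le> y" if "sol y" for y
      using x0(2)[of y] that sol0(2) by (cases "y \<le> x'") (auto simp: K_def sol_def)
    have "(LEAST x. sol x) = x0" by (rule Least_equality) (use sol0 least in auto)
    then have "\<eta> = x0 / 2" using True by (simp add: \<eta>_eq)
    moreover have "0 < x0" using sol0 by (simp add: sol_def)
    ultimately show ?thesis using sol0 x' least by fastforce
  qed
  then show "0 < \<eta>" "\<eta> < 1 / 2" "q_min q < ?v \<eta>" "?v \<eta> < q_max q"
    using between[of \<eta>] by auto
qed

text \<open>The left-hand side is the average computed in \<open>q_plateau_average\<close>.\<close>

lemma plateau_value_balance:
  "plateau_value q qbar \<eta> + \<eta> * (3 - 2 * \<eta>) / 6 * (edge_mean_sum q - 4 * plateau_value q qbar \<eta>) = qbar"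
proof -
  let ?d = "6 - 12 * \<eta> + 8 * \<eta>\<^sup>2"
  have "plateau_value q qbar \<eta> * ?d = 6 * qbar - \<eta> * (3 - 2 * \<eta>) * edge_mean_sum q"
    unfolding plateau_value_def using plateau_denominator_pos[of \<eta>] by simp
  then show ?thesis by (simp add: power2_eq_square field_simps)
qed

section \<open>The combined reconstruction\<close>

lemma q_recon_unit_cases:
  obtains "q_recon 1 1 q qbar = q_pw 1 1 q qbar"
      "q_min q < qbar \<and> qbar < q_max q \<Longrightarrow>
        \<forall>z \<in> cell 1 1. q_min q \<le> q_pw 1 1 q qbar z \<and> q_pw 1 1 q qbar z \<le> q_max q"
  | \<eta> where "q_min q < qbar" "qbar < q_max q" "\<eta> = plateau_eta q qbar"
      "q_recon 1 1 q qbar = q_plateau_at \<eta> (plateau_value q qbar \<eta>) 1 1 q"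
  unfolding q_recon_def q_plateau_def Let_def by (metis (mono_tags, lifting))

lemma q_recon_unit_edges:
  assumes "-1/2 \<le> t" "t \<le> 1/2"
  shows "q_recon 1 1 q qbar (- 1 / 2, t) = profile (type_W q) (q SouthWest) (q West) (q NorthWest) (2 * t)"
    and "q_recon 1 1 q qbar (1 / 2, t) = profile (type_E q) (q SouthEast) (q East) (q NorthEast) (2 * t)"
    and "q_recon 1 1 q qbar (t, 1 / 2) = profile (type_N q) (q NorthWest) (q North) (q NorthEast) (2 * t)"
    and "q_recon 1 1 q qbar (t, - 1 / 2) = profile (type_S q) (q SouthWest) (q South) (q SouthEast) (2 * t)"
  by (cases rule: q_recon_unit_cases[where q = q and qbar = qbar];
      simp only: q_pw_edges[OF assms] q_plateau_edges[OF plateau_parameters(1,2) assms])+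

lemma continuous_on_q_recon_unit: "continuous_on (cell 1 1) (q_recon 1 1 q qbar)"
  by (cases rule: q_recon_unit_cases[where q = q and qbar = qbar])
    (simp_all only: continuous_on_q_pw continuous_on_q_plateau plateau_parameters)

lemma q_recon_unit_average:
  "has_bochner_integral lborel (\<lambda>z. indicator (cell 1 1) z * q_recon 1 1 q qbar z) qbar"
proof (cases rule: q_recon_unit_cases[where q = q and qbar = qbar])
  case 1
  then show ?thesis using q_pw_average by simp
next
  case (2 \<eta>)
  then show ?thesis
    using q_plateau_average[of \<eta> "plateau_value q qbar \<eta>" q, unfolded plateau_value_balance]
      plateau_parameters[of q qbar] by simp
qed

lemma q_recon_unit_bounds:
  assumes "q_min q < qbar" "qbar < q_max q" "z \<in> cell 1 1"
  shows "q_min q \<le> q_recon 1 1 q qbar z \<and> q_recon 1 1 q qbar z \<le> q_max q"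
proof (cases rule: q_recon_unit_cases[where q = q and qbar = qbar])
  case 1
  then show ?thesis using assms by simp
next
  case (2 \<eta>)
  then show ?thesis
    using q_plateau_bounds[of \<eta> z "q_min q" "plateau_value q qbar \<eta>" "q_max q" q] assms(3)
      plateau_parameters[OF assms(1,2)] q_min_le[of q] q_max_ge[of q] by simp
qed

lemma cell_rescale:
  assumes "dx > 0" "dy > 0"
  shows "(x, y) \<in> cell dx dy \<longleftrightarrow> (x / dx, y / dy) \<in> cell 1 1"
  using assms by (auto simp: cell_def field_simps)

text \<open>All formulas involve \<open>x\<close> and \<open>y\<close> only through \<open>x / dx\<close> and \<open>y / dy\<close>, and the condition that selects
the reconstruction quantifies over the whole cell, so everything can be read off from the unit cell.\<close>

lemma q_recon_rescale:
  assumes "dx > 0" "dy > 0"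
  shows "q_recon dx dy q qbar (x, y) = q_recon 1 1 q qbar (x / dx, y / dy)"
proof -
  have pw: "q_pw dx dy q qbar (x, y) = q_pw 1 1 q qbar (x / dx, y / dy)" for x y
    by (simp add: q_pw_def Let_def)
  have pl: "q_plateau dx dy q qbar (x, y) = q_plateau 1 1 q qbar (x / dx, y / dy)" for x y
    by (simp add: q_plateau_def q_plateau_at_def Let_def del: T_fun.simps)
  have "(\<forall>z \<in> cell dx dy. P (q_pw dx dy q qbar z)) \<longleftrightarrow> (\<forall>z \<in> cell 1 1. P (q_pw 1 1 q qbar z))" for P
  proof
    assume L: "\<forall>z \<in> cell dx dy. P (q_pw dx dy q qbar z)"
    show "\<forall>z \<in> cell 1 1. P (q_pw 1 1 q qbar z)"
    proof
      fix z assume z: "z \<in> cell 1 1"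
      obtain X Y where XY: "z = (X * dx / dx, Y * dy / dy)"
        using assms by (cases z) (metis nonzero_mult_div_cancel_right less_irrefl)
      have "(X * dx, Y * dy) \<in> cell dx dy" using z unfolding XY cell_rescale[OF assms] .
      then have "P (q_pw dx dy q qbar (X * dx, Y * dy))" using L by blast
      then show "P (q_pw 1 1 q qbar z)" unfolding XY pw .
    qed
  next
    assume "\<forall>z \<in> cell 1 1. P (q_pw 1 1 q qbar z)"
    then show "\<forall>z \<in> cell dx dy. P (q_pw dx dy q qbar z)"
      using pw cell_rescale[OF assms] by auto
  qed
  from this[of "\<lambda>v. q_min q \<le> v \<and> v \<le> q_max q"] show ?thesis
    unfolding q_recon_def by (simp add: pw pl)
qed

lemma continuous_on_q_recon:
  assumes "dx > 0" "dy > 0"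
  shows "continuous_on (cell dx dy) (q_recon dx dy q qbar)"
proof -
  have "continuous_on (cell dx dy) (\<lambda>z. q_recon 1 1 q qbar (fst z / dx, snd z / dy))"
    using assms cell_rescale[OF assms]
    by (intro continuous_on_compose2[OF continuous_on_q_recon_unit] continuous_intros) auto
  then show ?thesis using q_recon_rescale[OF assms]
    by (simp add: case_prod_beta' flip: q_recon_rescale[OF assms])
qed

lemma q_recon_integral:
  assumes "dx > 0" "dy > 0"
  shows "integral (cell dx dy) (q_recon dx dy q qbar) = dx * dy * qbar"
proof -
  have "indicator (cell 1 1) (x / dx, y / dy) * q_recon 1 1 q qbar (x / dx, y / dy) =
      indicator (cell dx dy) (x, y) *\<^sub>R q_recon dx dy q qbar (x, y)" for x y
    using cell_rescale[OF assms, of x y] by (simp add: q_recon_rescale[OF assms] indicator_def)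
  then have "has_bochner_integral lborel
      (\<lambda>z. indicator (cell dx dy) z *\<^sub>R q_recon dx dy q qbar z) (dx * dy * qbar)"
    using has_bochner_integral_rescale[OF q_recon_unit_average assms, of q qbar]
    by (simp add: case_prod_beta')
  then show ?thesis
    using set_borel_integral_eq_integral(2)[of "cell dx dy" "q_recon dx dy q qbar"]
    by (simp add: has_bochner_integral_iff set_integrable_def set_lebesgue_integral_def)
qed

lemma q_recon_edges:
  assumes "dx > 0" "dy > 0"
  shows "y \<in> {- dy / 2..dy / 2} \<Longrightarrow> q_recon dx dy q qbar (- dx / 2, y) =
        profile (type_W q) (q SouthWest) (q West) (q NorthWest) (2 * (y / dy))"
    and "y \<in> {- dy / 2..dy / 2} \<Longrightarrow> q_recon dx dy q qbar (dx / 2, y) =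
        profile (type_E q) (q SouthEast) (q East) (q NorthEast) (2 * (y / dy))"
    and "x \<in> {- dx / 2..dx / 2} \<Longrightarrow> q_recon dx dy q qbar (x, dy / 2) =
        profile (type_N q) (q NorthWest) (q North) (q NorthEast) (2 * (x / dx))"
    and "x \<in> {- dx / 2..dx / 2} \<Longrightarrow> q_recon dx dy q qbar (x, - dy / 2) =
        profile (type_S q) (q SouthWest) (q South) (q SouthEast) (2 * (x / dx))"
proof -
  have t: "-1/2 \<le> v / d" "v / d \<le> 1/2" if "v \<in> {- d / 2..d / 2}" "d > 0" for v d :: real
    using that by (auto simp: field_simps)
  have [simp]: "- dx / 2 / dx = - 1 / 2" "dx / 2 / dx = 1 / 2" "- dy / 2 / dy = - 1 / 2" "dy / 2 / dy = 1 / 2"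
    using assms by auto
  note E = q_recon_unit_edges[OF t]
  show "q_recon dx dy q qbar (- dx / 2, y) =
        profile (type_W q) (q SouthWest) (q West) (q NorthWest) (2 * (y / dy))" if "y \<in> {- dy / 2..dy / 2}"
    unfolding q_recon_rescale[OF assms] using E(1)[OF that assms(2) that assms(2)] assms by simp
  show "q_recon dx dy q qbar (dx / 2, y) =
        profile (type_E q) (q SouthEast) (q East) (q NorthEast) (2 * (y / dy))" if "y \<in> {- dy / 2..dy / 2}"
    unfolding q_recon_rescale[OF assms] using E(2)[OF that assms(2) that assms(2)] assms by simp
  show "q_recon dx dy q qbar (x, dy / 2) =
        profile (type_N q) (q NorthWest) (q North) (q NorthEast) (2 * (x / dx))" if "x \<in> {- dx / 2..dx / 2}"
    unfolding q_recon_rescale[OF assms] using E(3)[OF that assms(1) that assms(1)] assms by simp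
  show "q_recon dx dy q qbar (x, - dy / 2) =
        profile (type_S q) (q SouthWest) (q South) (q SouthEast) (2 * (x / dx))" if "x \<in> {- dx / 2..dx / 2}"
    unfolding q_recon_rescale[OF assms] using E(4)[OF that assms(1) that assms(1)] assms by simp
qed

lemma q_recon_interpolates:
  assumes "dx > 0" "dy > 0"
  shows "q_recon dx dy q qbar (position dx dy l) = q l"
proof -
  show ?thesis
    using assms q_recon_edges(3)[OF assms, of "- dx / 2" q qbar] q_recon_edges(3)[OF assms, of 0 q qbar]
      q_recon_edges(3)[OF assms, of "dx / 2" q qbar]
      q_recon_edges(4)[OF assms, of "- dx / 2" q qbar] q_recon_edges(4)[OF assms, of 0 q qbar]
      q_recon_edges(4)[OF assms, of "dx / 2" q qbar]
      q_recon_edges(1)[OF assms, of 0 q qbar] q_recon_edges(2)[OF assms, of 0 q qbar]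
    by (cases l) simp_all
qed

theorem theorem3p1:
  fixes dx dy qbar :: real and q :: "location \<Rightarrow> real"
  assumes "dx > 0" and "dy > 0"
  shows "continuous_on (cell dx dy) (q_recon dx dy q qbar)
    \<and> (\<forall>l. q_recon dx dy q qbar (position dx dy l) = q l)
    \<and> 1 / (dx * dy) * integral (cell dx dy) (q_recon dx dy q qbar) = qbar
    \<and> (q_min q < qbar \<and> qbar < q_max q \<longrightarrow>
        (\<forall>z \<in> cell dx dy. q_min q \<le> q_recon dx dy q qbar z \<and> q_recon dx dy q qbar z \<le> q_max q))
    \<and> (q NorthWest < q North \<and> q North < q NorthEast \<longrightarrow>
        (\<forall>x \<in> {- dx / 2..dx / 2}. q NorthWest \<le> q_recon dx dy q qbar (x, dy / 2)
                                 \<and> q_recon dx dy q qbar (x, dy / 2) \<le> q NorthEast))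
    \<and> (q SouthWest < q South \<and> q South < q SouthEast \<longrightarrow>
        (\<forall>x \<in> {- dx / 2..dx / 2}. q SouthWest \<le> q_recon dx dy q qbar (x, - dy / 2)
                                 \<and> q_recon dx dy q qbar (x, - dy / 2) \<le> q SouthEast))
    \<and> (q SouthWest < q West \<and> q West < q NorthWest \<longrightarrow>
        (\<forall>y \<in> {- dy / 2..dy / 2}. q SouthWest \<le> q_recon dx dy q qbar (- dx / 2, y)
                                 \<and> q_recon dx dy q qbar (- dx / 2, y) \<le> q NorthWest))
    \<and> (q SouthEast < q East \<and> q East < q NorthEast \<longrightarrow>
        (\<forall>y \<in> {- dy / 2..dy / 2}. q SouthEast \<le> q_recon dx dy q qbar (dx / 2, y)
                                 \<and> q_recon dx dy q qbar (dx / 2, y) \<le> q NorthEast))"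
proof (intro conjI[OF continuous_on_q_recon[OF assms]] conjI)
  show "\<forall>l. q_recon dx dy q qbar (position dx dy l) = q l"
    using q_recon_interpolates[OF assms] by blast
  show "1 / (dx * dy) * integral (cell dx dy) (q_recon dx dy q qbar) = qbar"
    using assms by (simp add: q_recon_integral)
  show "q_min q < qbar \<and> qbar < q_max q \<longrightarrow>
      (\<forall>z \<in> cell dx dy. q_min q \<le> q_recon dx dy q qbar z \<and> q_recon dx dy q qbar z \<le> q_max q)"
    using q_recon_unit_bounds[of q qbar] cell_rescale[OF assms] q_recon_rescale[OF assms]
    by auto
  note edges = q_recon_edges[OF assms, of _ q qbar]
  show "q NorthWest < q North \<and> q North < q NorthEast \<longrightarrow>
        (\<forall>x \<in> {- dx / 2..dx / 2}. q NorthWest \<le> q_recon dx dy q qbar (x, dy / 2)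
                                 \<and> q_recon dx dy q qbar (x, dy / 2) \<le> q NorthEast)"
    by (intro impI ballI) (simp only: edges(3) type_N_def profile_within_ends[OF _ _ _ assms(1)] simp_thms)
  show "q SouthWest < q South \<and> q South < q SouthEast \<longrightarrow>
        (\<forall>x \<in> {- dx / 2..dx / 2}. q SouthWest \<le> q_recon dx dy q qbar (x, - dy / 2)
                                 \<and> q_recon dx dy q qbar (x, - dy / 2) \<le> q SouthEast)"
    by (intro impI ballI) (simp only: edges(4) type_S_def profile_within_ends[OF _ _ _ assms(1)] simp_thms)
  show "q SouthWest < q West \<and> q West < q NorthWest \<longrightarrow>
        (\<forall>y \<in> {- dy / 2..dy / 2}. q SouthWest \<le> q_recon dx dy q qbar (- dx / 2, y)
                                 \<and> q_recon dx dy q qbar (- dx / 2, y) \<le> q NorthWest)"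
    by (intro impI ballI) (simp only: edges(1) type_W_def profile_within_ends[OF _ _ _ assms(2)] simp_thms)
  show "q SouthEast < q East \<and> q East < q NorthEast \<longrightarrow>
        (\<forall>y \<in> {- dy / 2..dy / 2}. q SouthEast \<le> q_recon dx dy q qbar (dx / 2, y)
                                 \<and> q_recon dx dy q qbar (dx / 2, y) \<le> q NorthEast)"
    by (intro impI ballI) (simp only: edges(2) type_E_def profile_within_ends[OF _ _ _ assms(2)] simp_thms)
qed

end
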